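(* Let $\mathcal Y$ be a Hilbert space and suppose that $\mathcal M$ is a closed, shift-invariant subspace of $H^2_{\mathcal Y}(\mathcal F_d)$ (i.e. $S_j\mathcal M\subset\mathcal M$ for $j=1,\dots,d$). Then there is an isometric input pair $(\mathbf Z,X)$ with $\mathbf Z^*=(Z_1^*,\dots,Z_d^* )$ strongly stable such that $\mathcal M=\mathcal M_{\mathbf Z,X}$.
   Context: $d\ge1$ is a fixed integer and $\mathcal F_d$ is the free semigroup with unit generated by the letters $\{1,\dots,d\}$: words $v=i_N\cdots i_1$ of length $|v|=N$, product given by concatenation, unit the empty word $\emptyset$; $v^\top=i_1\cdots i_N$. $z=(z_1,\dots,z_d)$ are noncommuting indeterminates; $z^v=z_{i_N}\cdots z_{i_1}$, $z^\emptyset=1$; for an operator tuple $\mathbf A=(A_1,\dots,A_d)$, $\mathbf A^v=A_{i_N}\cdots A_{i_1}$, $\mathbf A^\emptyset=I$. $H^2_{\mathcal Y}(\mathcal F_d)=\{f=\sum_vf_vz^v:\ f_v\in\mathcal Y,\ \|f\|^2=\sum_v\|f_v\|^2<\infty\}$. The (right) shifts on it are $S_j:f(z)\mapsto f(z)z_j$, i.e. $\sum_vf_vz^v\mapsto\sum_vf_vz^{vj}$. An input pair $(\mathbf Z,X)$ consists of $\mathbf Z=(Z_1,\dots,Z_d)$ with bounded $Z_j:\mathcal X\to\mathcal X$ and bounded $X:\mathcal Y\to\mathcal X$, for some Hilbert space $\mathcal X$. It is isometric if $I_{\mathcal X}-Z_1Z_1^*-\cdots-Z_dZ_d^*=XX^*$.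 A tuple $\mathbf A$ on $\mathcal X$ is strongly stable if $\lim_{N\to\infty}\sum_{|v|=N}\|\mathbf A^vx\|^2=0$ for all $x\in\mathcal X$. For an isometric input pair with $\mathbf Z^*$ strongly stable, the left evaluation with operator argument of $f=\sum_vf_vz^v\in H^2_{\mathcal Y}(\mathcal F_d)$ is $$(Xf)^{\wedge L}(\mathbf Z)=\sum_{v\in\mathcal F_d}\mathbf Z^{v^\top}Xf_v=:\mathcal C_{\mathbf Z,X}f\in\mathcal X,$$ and $\mathcal M_{\mathbf Z,X}=\{f\in H^2_{\mathcal Y}(\mathcal F_d):(Xf)^{\wedge L}(\mathbf Z)=0\}$. *)

theory Defs
  imports "HOL-Analysis.Analysis" "HOL-Algebra.Module" "HOL-Decision_Procs.Algebra_Aux"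
begin

section \<open>Complex Hilbert spaces\<close>

text \<open>
  Hilbert spaces are carrier-based structures in the style of HOL-Algebra, because the state space
  of an input pair is existentially quantified. The underlying vector space is a module over the
  complex field (\<open>cring_class_ops\<close> is the type \<open>complex\<close> as a ring record); the fields \<open>mult\<close> and \<open>one\<close> inherited from the record of rings play no role.
  The inner product is linear in its first argument.
\<close>

record 'v hilbert = "(complex, 'v) module" +
  ip :: "'v \<Rightarrow> 'v \<Rightarrow> complex"

locale complex_inner_space =
  Module.module "cring_class_ops :: complex ring" H for H :: "'v hilbert" (structure) +
  assumes ip_add_left:
      "\<lbrakk>x \<in> carrier H; y \<in> carrier H; z \<in> carrier H\<rbrakk> \<Longrightarrow> ip H (x \<oplus> y) z = ip H x z + ip H y z"
    and ip_smult_left: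
      "\<lbrakk>x \<in> carrier H; y \<in> carrier H\<rbrakk> \<Longrightarrow> ip H (a \<odot> x) y = a * ip H x y"
    and ip_commute:
      "\<lbrakk>x \<in> carrier H; y \<in> carrier H\<rbrakk> \<Longrightarrow> ip H y x = cnj (ip H x y)"
    and ip_ge_zero: "x \<in> carrier H \<Longrightarrow> 0 \<le> Re (ip H x x)"
    and ip_eq_zeroD: "\<lbrakk>x \<in> carrier H; ip H x x = 0\<rbrakk> \<Longrightarrow> x = \<zero>"

definition hnorm :: "'v hilbert \<Rightarrow> 'v \<Rightarrow> real"
  where "hnorm H x = sqrt (Re (ip H x x))"

text \<open>
  The locale \<open>Metric_space\<close> requires symmetry and nonnegativity of the distance on the whole type,
  so the distance is set to zero outside the carrier.
\<close>

definition hdist :: "'v hilbert \<Rightarrow> 'v \<Rightarrow> 'v \<Rightarrow> real"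
  where "hdist H x y = (if x \<in> carrier H \<and> y \<in> carrier H then hnorm H (x \<ominus>\<^bsub>H\<^esub> y) else 0)"

abbreviation htopology :: "'v hilbert \<Rightarrow> 'v topology"
  where "htopology H \<equiv> Metric_space.mtopology (carrier H) (hdist H)"

locale complex_hilbert_space = complex_inner_space +
  assumes complete: "Metric_space.mcomplete (carrier H) (hdist H)"

definition closed_subspace :: "'v hilbert \<Rightarrow> 'v set \<Rightarrow> bool"
  where "closed_subspace H M \<longleftrightarrow>
    submodule M (cring_class_ops :: complex ring) H \<and> closedin (htopology H) M"

text \<open>Unordered (unconditional) norm convergence of a series, as in \<open>has_sum\<close>.\<close>

definition has_hsum :: "'v hilbert \<Rightarrow> ('i \<Rightarrow> 'v) \<Rightarrow> 'i set \<Rightarrow> 'v \<Rightarrow> bool"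
  where "has_hsum H f I s \<longleftrightarrow> limitin (htopology H) (finsum H f) s (finite_subsets_at_top I)"

definition bounded_op :: "'v hilbert \<Rightarrow> 'w hilbert \<Rightarrow> ('v \<Rightarrow> 'w) \<Rightarrow> bool"
  where "bounded_op H K T \<longleftrightarrow>
    T \<in> carrier H \<rightarrow> carrier K \<and>
    (\<forall>x\<in>carrier H. \<forall>y\<in>carrier H. T (x \<oplus>\<^bsub>H\<^esub> y) = T x \<oplus>\<^bsub>K\<^esub> T y) \<and>
    (\<forall>a. \<forall>x\<in>carrier H. T (a \<odot>\<^bsub>H\<^esub> x) = a \<odot>\<^bsub>K\<^esub> T x) \<and>
    (\<exists>B. \<forall>x\<in>carrier H. hnorm K (T x) \<le> B * hnorm H x)"

text \<open>The Hilbert space adjoint; only its values on \<open>carrier K\<close> are meaningful.\<close>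

definition adjoint_op :: "'v hilbert \<Rightarrow> 'w hilbert \<Rightarrow> ('v \<Rightarrow> 'w) \<Rightarrow> 'w \<Rightarrow> 'v"
  where "adjoint_op H K T y =
    (THE x. x \<in> carrier H \<and> (\<forall>h\<in>carrier H. ip K (T h) y = ip H h x))"


section \<open>The Fock space and its right shifts\<close>

text \<open>
  The letters are the elements of a finite type \<open>'d\<close> with \<open>d = CARD('d)\<close>, so the free semigroup is
  the type \<open>'d list\<close>; the word \<open>i\<^sub>N\<cdots>i\<^sub>1\<close> is the list \<open>[i\<^sub>N, \<dots>, i\<^sub>1]\<close>. A formal power
  series is identified with its coefficient function.
\<close>

definition H2 :: "'y hilbert \<Rightarrow> ('d::finite list \<Rightarrow> 'y) hilbert"
  where "H2 Y = \<lparr>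
    carrier = {f. (\<forall>v. f v \<in> carrier Y) \<and> (\<lambda>v. (hnorm Y (f v))\<^sup>2) summable_on UNIV},
    mult = undefined, one = undefined,
    zero = (\<lambda>v. \<zero>\<^bsub>Y\<^esub>),
    add = (\<lambda>f g v. f v \<oplus>\<^bsub>Y\<^esub> g v),
    smult = (\<lambda>a f v. a \<odot>\<^bsub>Y\<^esub> f v),
    ip = (\<lambda>f g. \<Sum>\<^sub>\<infinity>v. ip Y (f v) (g v))\<rparr>"

text \<open>\<open>f(z) \<mapsto> f(z) z\<^sub>j\<close>: the coefficient of \<open>z\<^bsup>vj\<^esup>\<close> is \<open>f v\<close>, all other coefficients vanish.\<close>

definition shift :: "'y hilbert \<Rightarrow> 'd \<Rightarrow> ('d list \<Rightarrow> 'y) \<Rightarrow> ('d list \<Rightarrow> 'y)"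
  where "shift Y j f = (\<lambda>w. if w \<noteq> [] \<and> last w = j then f (butlast w) else \<zero>\<^bsub>Y\<^esub>)"


section \<open>Input pairs and left evaluation with operator argument\<close>

text \<open>\<open>op_word A [i\<^sub>N, \<dots>, i\<^sub>1] = A i\<^sub>N \<circ> \<cdots> \<circ> A i\<^sub>1\<close>\<close>

definition op_word :: "('d \<Rightarrow> 'x \<Rightarrow> 'x) \<Rightarrow> 'd list \<Rightarrow> 'x \<Rightarrow> 'x"
  where "op_word A v = foldr A v"

definition input_pair ::
    "'y hilbert \<Rightarrow> 'x hilbert \<Rightarrow> ('d::finite \<Rightarrow> 'x \<Rightarrow> 'x) \<Rightarrow> ('y \<Rightarrow> 'x) \<Rightarrow> bool"
  where "input_pair Y H Z X \<longleftrightarrow>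
    complex_hilbert_space H \<and> (\<forall>j. bounded_op H H (Z j)) \<and> bounded_op Y H X"

definition isometric_input_pair ::
    "'y hilbert \<Rightarrow> 'x hilbert \<Rightarrow> ('d::finite \<Rightarrow> 'x \<Rightarrow> 'x) \<Rightarrow> ('y \<Rightarrow> 'x) \<Rightarrow> bool"
  where "isometric_input_pair Y H Z X \<longleftrightarrow>
    input_pair Y H Z X \<and>
    (\<forall>x\<in>carrier H.
      x \<ominus>\<^bsub>H\<^esub> (\<Oplus>\<^bsub>H\<^esub>j\<in>UNIV. Z j (adjoint_op H H (Z j) x)) = X (adjoint_op Y H X x))"

definition strongly_stable :: "'x hilbert \<Rightarrow> ('d::finite \<Rightarrow> 'x \<Rightarrow> 'x) \<Rightarrow> bool"
  where "strongly_stable H A \<longleftrightarrow>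
    (\<forall>x\<in>carrier H. (\<lambda>N. \<Sum>v | length v = N. (hnorm H (op_word A v x))\<^sup>2) \<longlonglongrightarrow> 0)"

text \<open>\<open>has_left_eval H Z X f s\<close>: the series defining the left evaluation converges to \<open>s\<close>.\<close>

definition has_left_eval ::
    "'x hilbert \<Rightarrow> ('d \<Rightarrow> 'x \<Rightarrow> 'x) \<Rightarrow> ('y \<Rightarrow> 'x) \<Rightarrow> ('d list \<Rightarrow> 'y) \<Rightarrow> 'x \<Rightarrow> bool"
  where "has_left_eval H Z X f s \<longleftrightarrow> has_hsum H (\<lambda>v. op_word Z (rev v) (X (f v))) UNIV s"

definition eval_kernel ::
    "'y hilbert \<Rightarrow> 'x hilbert \<Rightarrow> ('d::finite \<Rightarrow> 'x \<Rightarrow> 'x) \<Rightarrow> ('y \<Rightarrow> 'x) \<Rightarrow> ('d list \<Rightarrow> 'y) set"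
  where "eval_kernel Y H Z X = {f \<in> carrier (H2 Y). has_left_eval H Z X f \<zero>\<^bsub>H\<^esub>}"

end

theory Submission
  imports Defs
begin

text \<open>
  The pair is obtained by compressing the shifts to the orthogonal complement \<open>N\<close> of \<open>M\<close>. Let \<open>P\<close> be the
  projection onto \<open>N\<close>, let \<open>Z\<^sub>j f = P (S\<^sub>j f)\<close> for \<open>f\<close> in \<open>N\<close>, and let \<open>X y\<close> be the projection of the constant
  series \<open>y\<close>.

  Since the shifts map \<open>M\<close> into itself, the backward shifts \<open>S\<^sub>j\<^sup>*\<close>, which delete a last letter \<open>j\<close>, map \<open>N\<close>
  into itself; so \<open>Z\<^sub>j\<^sup>*\<close> is the backward shift on \<open>N\<close> (\<open>adjoint_Z\<close>), and \<open>X\<^sup>*\<close> takes the constant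
  coefficient (\<open>adjoint_X\<close>). The isometry condition is the projection of the identity
  \<open>f - \<Sum>\<^sub>j S\<^sub>j S\<^sub>j\<^sup>* f = f\<^sub>\<emptyset>\<close> (\<open>isometric\<close>). Strong stability holds because applying all words of length \<open>n\<close>
  in the backward shifts to \<open>f\<close> and adding the squared norms leaves the part of \<open>\<parallel>f\<parallel>\<^sup>2\<close> carried by the words
  of length at least \<open>n\<close>, the tail of a convergent series (\<open>sum_hnorm_backshift_words\<close>, \<open>tail_tendsto\<close>).

  Invariance of \<open>M\<close> also gives \<open>P S\<^sub>j P = P S\<^sub>j\<close>, so the \<open>v\<close>-th term of the left evaluation of \<open>f\<close> is
  \<open>P (f\<^sub>v z\<^sup>v)\<close>, and the evaluation is \<open>P f\<close> (\<open>left_eval_eq_P\<close>). It vanishes exactly when \<open>f\<close> lies in \<open>M\<close>.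

  What this rests on is elementary Hilbert space geometry for spaces given by carriers: the projection
  onto a closed subspace (\<open>orth_decomposition\<close>), completeness of orthogonal complements
  (\<open>complex_hilbert_space_orth_compl\<close>), and completeness of the space of square summable series
  (\<open>complex_hilbert_space_H2\<close>).
\<close>

section \<open>Geometry of carrier-based inner product spaces\<close>

context complex_inner_space
begin

lemma smult_carrier [simp, intro]: "x \<in> carrier H \<Longrightarrow> a \<odot> x \<in> carrier H"
  by (rule smult_closed) (rule carrier_class)

lemma one_smult [simp]: "x \<in> carrier H \<Longrightarrow> 1 \<odot> x = x"
  using smult_one by (simp add: class_simps)

lemma smult_add_left: "x \<in> carrier H \<Longrightarrow> (a + b) \<odot> x = a \<odot> x \<oplus> b \<odot> x"
  using smult_l_distr[of a b x] by (simp add: class_simps)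

lemma smult_mult: "x \<in> carrier H \<Longrightarrow> (a * b) \<odot> x = a \<odot> (b \<odot> x)"
  using smult_assoc1[of a b x] by (simp add: class_simps)

text \<open>
  The additive inverse of a structure is a description operator over its carrier, so it is not
  literally the same term for a space and for a subspace. Written with the scalar \<open>-1\<close>, differences
  only involve operations that a subspace shares with the ambient space.
\<close>

lemma minus_eq_smult: 
  assumes "x \<in> carrier H" "y \<in> carrier H" 
  shows "x \<ominus> y = x \<oplus> (-1) \<odot> y"
  using assms smult_l_minus[of 1 y] one_smult[of y]
  by (simp add: a_minus_def class_simps)

lemma zero_eq_smult: "x \<in> carrier H \<Longrightarrow> \<zero> = 0 \<odot> x"
  using smult_l_null[of x] by (simp add: class_simps)

lemma minus_eq_zero_iff [simp]:
  assumes "x \<in> carrier H" "y \<in> carrier H"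
  shows "x \<ominus> y = \<zero> \<longleftrightarrow> x = y"
proof
  assume "x \<ominus> y = \<zero>"
  then have "\<ominus> (\<ominus> y) = x" using assms by (intro M.minus_equality) (simp_all add: a_minus_def)
  then show "x = y" using assms by simp
qed (use assms in \<open>simp add: a_minus_def M.r_neg\<close>)

lemma ip_zero_left: "y \<in> carrier H \<Longrightarrow> ip H \<zero> y = 0"
  using ip_smult_left[of y y 0] zero_eq_smult[of y] by simp

lemma ip_zero_right: "y \<in> carrier H \<Longrightarrow> ip H y \<zero> = 0"
  using ip_commute[of \<zero> y] ip_zero_left[of y] by simp

lemma ip_add_right:
  "\<lbrakk>x \<in> carrier H; y \<in> carrier H; z \<in> carrier H\<rbrakk> \<Longrightarrow> ip H x (y \<oplus> z) = ip H x y + ip H x z"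
  using ip_commute[of "y \<oplus> z" x] ip_commute[of y x] ip_commute[of z x] ip_add_left[of y z x] by simp

lemma ip_smult_right:
  "\<lbrakk>x \<in> carrier H; y \<in> carrier H\<rbrakk> \<Longrightarrow> ip H x (a \<odot> y) = cnj a * ip H x y"
  using ip_commute[of "a \<odot> y" x] ip_commute[of y x] ip_smult_left[of y x a] by simp

lemma ip_minus_left:
  "\<lbrakk>x \<in> carrier H; y \<in> carrier H; z \<in> carrier H\<rbrakk> \<Longrightarrow> ip H (x \<ominus> y) z = ip H x z - ip H y z"
  by (simp add: minus_eq_smult ip_add_left ip_smult_left)

lemma ip_minus_right:
  "\<lbrakk>x \<in> carrier H; y \<in> carrier H; z \<in> carrier H\<rbrakk> \<Longrightarrow> ip H x (y \<ominus> z) = ip H x y - ip H x z"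
  by (simp add: minus_eq_smult ip_add_right ip_smult_right)

lemmas ip_simps = ip_zero_left ip_zero_right ip_add_left ip_add_right ip_smult_left ip_smult_right
  ip_minus_left ip_minus_right

text \<open>
  Vector identities become identities of complex numbers: pairing both sides with an arbitrary vector
  and expanding by \<open>ip_simps\<close> replaces rearrangements in the carrier by arithmetic.
\<close>

lemma inner_extI:
  assumes "x \<in> carrier H" "y \<in> carrier H" "\<And>z. z \<in> carrier H \<Longrightarrow> ip H x z = ip H y z"
  shows "x = y"
proof -
  have "ip H (x \<ominus> y) (x \<ominus> y) = 0"
    using assms by (simp add: ip_minus_left)
  then have "x \<ominus> y = \<zero>" using assms by (intro ip_eq_zeroD) auto
  then show ?thesis using assms by simp
qed

lemma ip_self: "x \<in> carrier H \<Longrightarrow> ip H x x = of_real ((hnorm H x)\<^sup>2)"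
proof -
  assume x: "x \<in> carrier H"
  then have "Im (ip H x x) = - Im (ip H x x)"
    using ip_commute[of x x] by (metis cnj.simps(2))
  then show ?thesis using ip_ge_zero[OF x] by (simp add: hnorm_def complex_eq_iff)
qed

lemma hnorm_sq: "x \<in> carrier H \<Longrightarrow> (hnorm H x)\<^sup>2 = Re (ip H x x)"
  by (simp add: ip_self)

lemma hnorm_nonneg [simp]: "x \<in> carrier H \<Longrightarrow> 0 \<le> hnorm H x"
  by (simp add: hnorm_def ip_ge_zero)

lemma hnorm_zero [simp]: "hnorm H \<zero> = 0"
  by (simp add: hnorm_def ip_zero_left)

lemma hnorm_eq_0D: "x \<in> carrier H \<Longrightarrow> hnorm H x = 0 \<Longrightarrow> x = \<zero>"
  using ip_self[of x] by (intro ip_eq_zeroD) auto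

lemma hnorm_minus_self [simp]: "x \<in> carrier H \<Longrightarrow> hnorm H (x \<ominus> x) = 0"
  using minus_eq_zero_iff[of x x] by (simp del: minus_eq_zero_iff)

lemma hnorm_smult: "x \<in> carrier H \<Longrightarrow> hnorm H (a \<odot> x) = cmod a * hnorm H x"
proof -
  assume x: "x \<in> carrier H"
  have "ip H (a \<odot> x) (a \<odot> x) = of_real ((cmod a * hnorm H x)\<^sup>2)"
    using x complex_norm_square[of a] ip_self[of x] by (simp add: ip_simps power_mult_distrib algebra_simps)
  then show ?thesis using x by (simp add: hnorm_def[of H "a \<odot> x"])
qed

lemma hnorm_add_sq:
  "\<lbrakk>x \<in> carrier H; y \<in> carrier H\<rbrakk> \<Longrightarrow> 
    (hnorm H (x \<oplus> y))\<^sup>2 = (hnorm H x)\<^sup>2 + 2 * Re (ip H x y) + (hnorm H y)\<^sup>2"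
  using ip_commute[of x y] by (simp add: hnorm_sq ip_simps)

lemma hnorm_diff_sq:
  "\<lbrakk>x \<in> carrier H; y \<in> carrier H\<rbrakk> \<Longrightarrow> 
    (hnorm H (x \<ominus> y))\<^sup>2 = (hnorm H x)\<^sup>2 - 2 * Re (ip H x y) + (hnorm H y)\<^sup>2"
  using ip_commute[of x y] by (simp add: hnorm_sq ip_simps)

text \<open>Expand \<open>0 \<le> \<parallel>t x - s y\<parallel>\<^sup>2\<close> with \<open>t = \<parallel>y\<parallel>\<^sup>2\<close> and \<open>s = \<langle>x, y\<rangle>\<close>.\<close>

lemma Cauchy_Schwarz:
  assumes x: "x \<in> carrier H" and y: "y \<in> carrier H"
  shows "cmod (ip H x y) \<le> hnorm H x * hnorm H y"
proof (cases "hnorm H y = 0")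
  case True
  then have "y = \<zero>" using y hnorm_eq_0D by simp
  then show ?thesis using x by (simp add: ip_zero_right)
next
  case False
  define t where "t = (hnorm H y)\<^sup>2"
  define c where "c = ip H x y"
  have yx: "ip H y x = cnj c" using ip_commute[OF x y] by (simp add: c_def)
  have cmod_sq: "(cmod c)\<^sup>2 = Re c * Re c + Im c * Im c"
    unfolding cmod_power2 by (simp add: monoid_mult_class.power2_eq_square)
  have t: "t > 0" using False by (simp add: t_def)
  have "0 \<le> Re (ip H (of_real t \<odot> x \<ominus> c \<odot> y) (of_real t \<odot> x \<ominus> c \<odot> y))"
    using x y by (intro ip_ge_zero) auto
  also have "\<dots> = t * (t * (hnorm H x)\<^sup>2 - (cmod c)\<^sup>2)"
    using x y
    by (simp add: ip_simps ip_self[OF x] ip_self[OF y] yx flip: c_def t_def)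
      (simp add: cmod_sq algebra_simps)
  finally have "(cmod c)\<^sup>2 \<le> (hnorm H x * hnorm H y)\<^sup>2"
    using t by (simp add: zero_le_mult_iff t_def power_mult_distrib mult.commute)
  then have "cmod c \<le> hnorm H x * hnorm H y"
    by (rule power2_le_imp_le) (use x y in simp)
  then show ?thesis by (simp add: c_def)
qed

lemma hnorm_triangle:
  assumes x: "x \<in> carrier H" and y: "y \<in> carrier H"
  shows "hnorm H (x \<oplus> y) \<le> hnorm H x + hnorm H y"
proof -
  have "Re (ip H x y) \<le> hnorm H x * hnorm H y"
    using Cauchy_Schwarz[OF x y] complex_Re_le_cmod order_trans by blast
  then have "(hnorm H (x \<oplus> y))\<^sup>2 \<le> (hnorm H x + hnorm H y)\<^sup>2"
    using x y by (simp add: hnorm_add_sq power2_sum)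
  then show ?thesis by (rule power2_le_imp_le) (use x y in simp)
qed

lemma hnorm_minus_commute:
  "\<lbrakk>x \<in> carrier H; y \<in> carrier H\<rbrakk> \<Longrightarrow> hnorm H (x \<ominus> y) = hnorm H (y \<ominus> x)"
  using ip_commute[of x y] by (simp add: hnorm_def ip_simps)

lemma hnorm_triangle_minus:
  assumes "x \<in> carrier H" "y \<in> carrier H" "z \<in> carrier H"
  shows "hnorm H (x \<ominus> z) \<le> hnorm H (x \<ominus> y) + hnorm H (y \<ominus> z)"
proof -
  have "x \<ominus> z = (x \<ominus> y) \<oplus> (y \<ominus> z)"
    using assms by (intro inner_extI) (simp_all add: ip_simps)
  then show ?thesis using assms hnorm_triangle[of "x \<ominus> y" "y \<ominus> z"] by simp
qed

lemma Metric_space_hdist: "Metric_space (carrier H) (hdist H)"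
proof
  fix x y z
  show "0 \<le> hdist H x y" by (simp add: hdist_def)
  show "hdist H x y = hdist H y x" by (simp add: hdist_def hnorm_minus_commute)
  show "(hdist H x y = 0) = (x = y)" if "x \<in> carrier H" "y \<in> carrier H"
    using that hnorm_eq_0D[of "x \<ominus> y"] by (auto simp: hdist_def)
  show "hdist H x z \<le> hdist H x y + hdist H y z" 
    if "x \<in> carrier H" "y \<in> carrier H" "z \<in> carrier H"
    using that hnorm_triangle_minus by (simp add: hdist_def)
qed

sublocale metric: Metric_space "carrier H" "hdist H"
  by (rule Metric_space_hdist)

lemma limitin_iff_hnorm:
  assumes "\<And>i. f i \<in> carrier H" "l \<in> carrier H"
  shows "limitin (htopology H) f l F \<longleftrightarrow> ((\<lambda>i. hnorm H (f i \<ominus> l)) \<longlongrightarrow> 0) F"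
  using assms by (simp add: metric.limitin_metric_dist_null hdist_def)

text \<open>
  Completeness in terms of norms of differences is what can be compared between a space and a subspace,
  because the distance functions of the two differ off the smaller carrier.
\<close>

lemma mcomplete_iff_hnorm:
  "metric.mcomplete \<longleftrightarrow> (\<forall>\<sigma>. (\<forall>n. \<sigma> n \<in> carrier H) \<longrightarrow> 
     (\<forall>e>0. \<exists>N. \<forall>m\<ge>N. \<forall>n\<ge>N. hnorm H (\<sigma> m \<ominus> \<sigma> n) < e) \<longrightarrow>
     (\<exists>l\<in>carrier H. (\<lambda>n. hnorm H (\<sigma> n \<ominus> l)) \<longlonglongrightarrow> 0))" (is "_ \<longleftrightarrow> ?R")
proof -
  have C: "metric.MCauchy \<sigma> \<longleftrightarrow> (\<forall>n. \<sigma> n \<in> carrier H) \<and> 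
     (\<forall>e>0. \<exists>N. \<forall>m\<ge>N. \<forall>n\<ge>N. hnorm H (\<sigma> m \<ominus> \<sigma> n) < e)" for \<sigma>
  proof (cases "\<forall>n. \<sigma> n \<in> carrier H")
    case True
    then have "range \<sigma> \<subseteq> carrier H" "hdist H (\<sigma> m) (\<sigma> n) = hnorm H (\<sigma> m \<ominus> \<sigma> n)" for m n
      by (auto simp: hdist_def)
    then show ?thesis
      using True unfolding metric.MCauchy_def by auto
  qed (auto simp: metric.MCauchy_def)
  have L: "(\<exists>l. limitin (htopology H) \<sigma> l sequentially) \<longleftrightarrow> 
      (\<exists>l\<in>carrier H. (\<lambda>n. hnorm H (\<sigma> n \<ominus> l)) \<longlonglongrightarrow> 0)" if "\<forall>n. \<sigma> n \<in> carrier H" for \<sigma> 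
    using limitin_iff_hnorm[of \<sigma> _ sequentially] metric.limitin_mspace[of \<sigma> _ sequentially] that by metis
  show ?thesis
    unfolding metric.mcomplete_def C using L by blast
qed

text \<open>This continuity is the reason why orthogonal complements are closed.\<close>

lemma ip_limit_left:
  assumes f: "\<And>i. f i \<in> carrier H" and l: "l \<in> carrier H" and z: "z \<in> carrier H"
    and lim: "((\<lambda>i. hnorm H (f i \<ominus> l)) \<longlongrightarrow> 0) F"
  shows "((\<lambda>i. ip H (f i) z) \<longlongrightarrow> ip H l z) F"
proof -
  have "((\<lambda>i. hnorm H (f i \<ominus> l) * hnorm H z) \<longlongrightarrow> 0) F"
    using tendsto_mult_right[OF lim, of "hnorm H z"] by (simp add: mult.commute)
  moreover have "norm (ip H (f i) z - ip H l z) \<le> hnorm H (f i \<ominus> l) * hnorm H z" for i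
    using Cauchy_Schwarz[of "f i \<ominus> l" z] f l z by (simp add: ip_minus_left)
  ultimately have "((\<lambda>i. ip H (f i) z - ip H l z) \<longlongrightarrow> 0) F"
    by (intro Lim_null_comparison[of "\<lambda>i. ip H (f i) z - ip H l z"]) (auto intro: eventuallyI)
  then show ?thesis using Lim_null by blast
qed

lemma submoduleD:
  fixes a x y
  assumes "submodule N cring_class_ops H"
  shows "N \<subseteq> carrier H" "\<zero> \<in> N" "\<lbrakk>x \<in> N; y \<in> N\<rbrakk> \<Longrightarrow> x \<oplus> y \<in> N" "x \<in> N \<Longrightarrow> a \<odot> x \<in> N"
    "\<lbrakk>x \<in> N; y \<in> N\<rbrakk> \<Longrightarrow> x \<ominus> y \<in> N"
proof -
  note * = submoduleE[OF assms]
  show 1: "N \<subseteq> carrier H" by (rule *)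
  show "x \<in> N \<Longrightarrow> y \<in> N \<Longrightarrow> x \<oplus> y \<in> N" for x y by (rule *)
  show sm: "x \<in> N \<Longrightarrow> a \<odot> x \<in> N" for a x by (rule *) (auto simp: carrier_class)
  have "0 \<odot> x = \<zero>" if "x \<in> N" for x using zero_eq_smult[of x] that 1 by auto
  then show "\<zero> \<in> N" using sm[of _ 0] *(2) by (metis ex_in_conv)
  show "\<lbrakk>x \<in> N; y \<in> N\<rbrakk> \<Longrightarrow> x \<ominus> y \<in> N"
    using * by (simp add: a_minus_def)
qed

lemma submodule_by_scalarsI:
  assumes "N \<subseteq> carrier H" "\<zero> \<in> N" "\<And>x y. \<lbrakk>x \<in> N; y \<in> N\<rbrakk> \<Longrightarrow> x \<oplus> y \<in> N" 
    "\<And>a x. x \<in> N \<Longrightarrow> a \<odot> x \<in> N"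
  shows "submodule N cring_class_ops H"
proof (rule submoduleI)
  fix x assume x: "x \<in> N"
  then have "\<ominus> x = (-1) \<odot> x"
    using smult_l_minus[of 1 x] assms(1) one_smult[of x] by (auto simp: class_simps subset_eq)
  then show "\<ominus> x \<in> N" using x assms(4) by simp
qed (use assms in auto)

lemma complex_inner_space_submodule:
  assumes "submodule N cring_class_ops H"
  shows "complex_inner_space (H\<lparr>carrier := N\<rparr>)"
proof -
  note sub = submoduleD[OF assms]
  interpret S: Module.module "cring_class_ops :: complex ring" "H\<lparr>carrier := N\<rparr>"
    using submodule.submodule_is_module[OF assms] by (simp add: module_axioms)
  have "x \<in> carrier H" if "x \<in> N" for x using sub(1) that by blast
  then show ?thesis
    by unfold_locales (simp_all add: ip_add_left ip_smult_left ip_ge_zero ip_eq_zeroD flip: ip_commute)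
qed

lemma minus_submodule:
  assumes "submodule N cring_class_ops H" "x \<in> N" "y \<in> N"
  shows "x \<ominus>\<^bsub>H\<lparr>carrier := N\<rparr>\<^esub> y = x \<ominus> y"
  using complex_inner_space.minus_eq_smult[OF complex_inner_space_submodule[OF assms(1)], of x y]
    assms submoduleD(1)[OF assms(1)] by (simp add: minus_eq_smult subset_eq)

lemma hnorm_carrier_update [simp]: "hnorm (H\<lparr>carrier := N\<rparr>) = hnorm H"
  by (simp add: hnorm_def fun_eq_iff)

lemma finsum_submodule:
  assumes N: "submodule N cring_class_ops H" and A: "finite A" "\<And>a. a \<in> A \<Longrightarrow> f a \<in> N"
  shows "finsum (H\<lparr>carrier := N\<rparr>) f A = finsum H f A" "finsum H f A \<in> N"
proof -
  interpret S: complex_inner_space "H\<lparr>carrier := N\<rparr>" by (rule complex_inner_space_submodule[OF N])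
  note sub = submoduleD[OF N]
  have "finsum (H\<lparr>carrier := N\<rparr>) f A = finsum H f A \<and> finsum H f A \<in> N"
    using A
  proof (induction rule: finite_induct)
    case empty
    then show ?case using sub by simp
  next
    case (insert a A)
    then have 1: "f \<in> A \<rightarrow> N" "f \<in> A \<rightarrow> carrier H" "f a \<in> carrier H" using sub(1) by auto
    show ?case
      using insert 1 S.M.finsum_insert[of A a f] M.finsum_insert[of A a f] sub(3) by simp
  qed
  then show "finsum (H\<lparr>carrier := N\<rparr>) f A = finsum H f A" "finsum H f A \<in> N" by auto
qed

end

text \<open>
  A vector is determined by its inner products with all others, so the description defining the adjoint
  has at most one solution.
\<close>

lemma adjoint_op_eqI:
  assumes "complex_inner_space H" "x \<in> carrier H" "\<And>h. h \<in> carrier H \<Longrightarrow> ip K (T h) y = ip H h x"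
  shows "adjoint_op H K T y = x"
  unfolding adjoint_op_def
proof (rule the_equality)
  interpret complex_inner_space H by fact
  fix x' assume x': "x' \<in> carrier H \<and> (\<forall>h\<in>carrier H. ip K (T h) y = ip H h x')"
  show "x' = x"
  proof (rule inner_extI)
    fix z assume "z \<in> carrier H"
    then show "ip H x' z = ip H x z"
      using x' assms ip_commute[of z x'] ip_commute[of z x] by simp
  qed (use x' assms in auto)
qed (use assms in auto)

section \<open>Orthogonal projections\<close>

definition orth_compl :: "'v hilbert \<Rightarrow> 'v set \<Rightarrow> 'v set"
  where "orth_compl H M = {x \<in> carrier H. \<forall>m\<in>M. ip H x m = 0}"

text \<open>
  The orthogonal projection onto the complement of \<open>M\<close>, as the component of the decomposition
  along \<open>M\<close>; existence needs completeness and is shown in \<open>orth_decomposition\<close>.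
\<close>

definition compl_proj :: "'v hilbert \<Rightarrow> 'v set \<Rightarrow> 'v \<Rightarrow> 'v"
  where "compl_proj H M x = (THE p. p \<in> orth_compl H M \<and> (\<exists>m\<in>M. x = p \<oplus>\<^bsub>H\<^esub> m))"

lemma (in complex_inner_space) parallelogram_midpoint:
  assumes "x \<in> carrier H" "a \<in> carrier H" "b \<in> carrier H"
  shows "(hnorm H (a \<ominus> b))\<^sup>2 + 4 * (hnorm H (x \<ominus> of_real (1/2) \<odot> (a \<oplus> b)))\<^sup>2 =
    2 * (hnorm H (x \<ominus> a))\<^sup>2 + 2 * (hnorm H (x \<ominus> b))\<^sup>2"
  using assms by (simp add: hnorm_sq ip_simps algebra_simps)

text \<open>
  A minimising sequence for the distance from \<open>x\<close> to \<open>M\<close> is Cauchy: midpoints stay in \<open>M\<close>, hence are not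
  closer than the infimum, and the parallelogram identity then bounds the distance of two members of
  the sequence by their excess over the infimum.
\<close>

lemma (in complex_hilbert_space) ex_nearest_point:
  assumes M: "closed_subspace H M" and x: "x \<in> carrier H"
  shows "\<exists>q\<in>M. \<forall>m\<in>M. hnorm H (x \<ominus> q) \<le> hnorm H (x \<ominus> m)"
proof -
  have sub: "submodule M cring_class_ops H" and closed: "closedin (htopology H) M"
    using M by (auto simp: closed_subspace_def)
  note sub = submoduleD[OF sub]
  have carr: "m \<in> carrier H" if "m \<in> M" for m using sub(1) that by blast
  define g where "g m = (hnorm H (x \<ominus> m))\<^sup>2" for m
  define \<delta> where "\<delta> = Inf (g ` M)"
  have bdd: "bdd_below (g ` M)" by (rule bdd_belowI[of _ 0]) (auto simp: g_def)
  have \<delta>_le: "\<delta> \<le> g m" if "m \<in> M" for m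
    unfolding \<delta>_def using that bdd by (intro cInf_lower) auto
  have "\<exists>m\<in>M. g m < \<delta> + inverse (real (Suc n))" for n
  proof -
    have "Inf (g ` M) < \<delta> + inverse (real (Suc n))" by (simp add: \<delta>_def)
    then show ?thesis using cInf_lessD[of "g ` M"] sub(2) by blast
  qed
  then obtain \<sigma> where \<sigma>M: "\<And>n. \<sigma> n \<in> M" and g\<sigma>: "\<And>n. g (\<sigma> n) < \<delta> + inverse (real (Suc n))"
    by metis
  have \<sigma>: "\<sigma> n \<in> carrier H" for n using \<sigma>M carr by blast
  have dist_le: "(hnorm H (\<sigma> m \<ominus> \<sigma> n))\<^sup>2 \<le> 2 * inverse (real (Suc m)) + 2 * inverse (real (Suc n))" for m n
  proof -
    have "\<delta> \<le> g (of_real (1/2) \<odot> (\<sigma> m \<oplus> \<sigma> n))"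
      using \<sigma>M sub by (intro \<delta>_le) auto
    then show ?thesis
      using parallelogram_midpoint[OF x \<sigma>[of m] \<sigma>[of n]] g\<sigma>[of m] g\<sigma>[of n]
      unfolding g_def by linarith
  qed
  have "\<exists>N. \<forall>m\<ge>N. \<forall>n\<ge>N. hnorm H (\<sigma> m \<ominus> \<sigma> n) < e" if "e > 0" for e
  proof -
    obtain N where N: "inverse (real (Suc N)) < e\<^sup>2 / 4"
      using reals_Archimedean[of "e\<^sup>2 / 4"] \<open>e > 0\<close> by auto
    have "hnorm H (\<sigma> m \<ominus> \<sigma> n) < e" if mn: "m \<ge> N" "n \<ge> N" for m n
    proof (rule power2_less_imp_less)
      have "inverse (real (Suc m)) \<le> inverse (real (Suc N))" "inverse (real (Suc n)) \<le> inverse (real (Suc N))"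
        using mn by (auto intro!: le_imp_inverse_le)
      then show "(hnorm H (\<sigma> m \<ominus> \<sigma> n))\<^sup>2 < e\<^sup>2"
        using dist_le[of m n] N by linarith
    qed (use \<open>e > 0\<close> in simp)
    then show ?thesis by blast
  qed
  then obtain q where q: "q \<in> carrier H" and lim: "(\<lambda>n. hnorm H (\<sigma> n \<ominus> q)) \<longlonglongrightarrow> 0"
    using complete \<sigma> unfolding mcomplete_iff_hnorm by blast
  have "limitin (htopology H) \<sigma> q sequentially"
    using limitin_iff_hnorm[of \<sigma> q sequentially] \<sigma> q lim by simp
  then have qM: "q \<in> M"
    using closed \<sigma>M unfolding metric.metric_closedin_iff_sequentially_closed by blast
  have "hnorm H (x \<ominus> q) \<le> hnorm H (x \<ominus> m)" if m: "m \<in> M" for m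
  proof -
    have "hnorm H (x \<ominus> q) \<le> sqrt (\<delta> + inverse (real (Suc n))) + hnorm H (\<sigma> n \<ominus> q)" for n
    proof -
      have "hnorm H (x \<ominus> \<sigma> n) \<le> sqrt (\<delta> + inverse (real (Suc n)))"
        using g\<sigma>[of n] by (intro real_le_rsqrt) (simp add: g_def)
      then show ?thesis using hnorm_triangle_minus[OF x \<sigma>[of n] q] by linarith
    qed
    moreover have "(\<lambda>n. sqrt (\<delta> + inverse (real (Suc n))) + hnorm H (\<sigma> n \<ominus> q)) \<longlonglongrightarrow> sqrt (\<delta> + 0) + 0"
      by (intro tendsto_intros lim LIMSEQ_inverse_real_of_nat)
    ultimately have "hnorm H (x \<ominus> q) \<le> sqrt (\<delta> + 0) + 0"
      by (intro LIMSEQ_le_const) auto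
    also have "\<dots> \<le> sqrt (g m)" using \<delta>_le[OF m] by simp
    also have "\<dots> = hnorm H (x \<ominus> m)" using x carr[OF m] by (simp add: g_def)
    finally show ?thesis .
  qed
  with qM show ?thesis by blast
qed

text \<open>
  If \<open>c = \<langle>z, m\<rangle>\<close> were nonzero, subtracting a small positive multiple of \<open>c m\<close> would shorten \<open>z\<close>.
\<close>

lemma (in complex_inner_space) nearest_point_orthogonal:
  assumes z: "z \<in> carrier H" and m: "m \<in> carrier H"
    and min: "\<And>a. hnorm H z \<le> hnorm H (z \<ominus> a \<odot> m)"
  shows "ip H z m = 0"
proof -
  define c where "c = ip H z m"
  \<comment> \<open>The step length is at most \<open>1 / \<parallel>m\<parallel>\<^sup>2\<close>, so the linear gain beats the quadratic loss; the summand 1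
    covers \<open>m = 0\<close>.\<close>
  define s where "s = 1 / ((hnorm H m)\<^sup>2 + 1)"
  have pos: "(hnorm H m)\<^sup>2 + 1 > 0" by (simp add: add_nonneg_pos)
  then have s: "s > 0" "s * (hnorm H m)\<^sup>2 \<le> 1" by (simp_all add: s_def)
  have "(hnorm H z)\<^sup>2 \<le> (hnorm H (z \<ominus> (of_real s * c) \<odot> m))\<^sup>2"
    using min[of "of_real s * c"] z by (intro power_mono) auto
  also have "\<dots> = (hnorm H z)\<^sup>2 - 2 * Re (of_real s * (c * cnj c)) + (s * cmod c * hnorm H m)\<^sup>2"
    using z m s by (simp add: hnorm_diff_sq hnorm_smult norm_mult ip_smult_right mult_ac flip: c_def)
  also have "\<dots> = (hnorm H z)\<^sup>2 - s * (cmod c)\<^sup>2 * (2 - s * (hnorm H m)\<^sup>2)"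
    by (simp only: flip: complex_norm_square of_real_mult of_real_power)
      (simp add: monoid_mult_class.power2_eq_square algebra_simps)
  finally have "s * (cmod c)\<^sup>2 * (2 - s * (hnorm H m)\<^sup>2) \<le> 0" by simp
  then have "(cmod c)\<^sup>2 \<le> 0" using s by (simp add: mult_le_0_iff zero_less_mult_iff)
  then show ?thesis by (simp add: c_def)
qed

context complex_inner_space
begin

lemma orth_complD: "x \<in> orth_compl H M \<Longrightarrow> x \<in> carrier H" 
  "\<lbrakk>x \<in> orth_compl H M; m \<in> M\<rbrakk> \<Longrightarrow> ip H x m = 0"
  by (auto simp: orth_compl_def)

lemma submodule_orth_compl:
  assumes "M \<subseteq> carrier H"
  shows "submodule (orth_compl H M) cring_class_ops H"
proof -
  have "m \<in> carrier H" if "m \<in> M" for m using assms that by blast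
  then show ?thesis
    by (intro submodule_by_scalarsI) (auto simp: orth_compl_def ip_simps)
qed

text \<open>Two decompositions differ by a vector of \<open>M\<close> that is orthogonal to \<open>M\<close>, hence by zero.\<close>

lemma compl_proj_eqI:
  assumes M: "submodule M cring_class_ops H" and p: "p \<in> orth_compl H M" and m: "m \<in> M" 
    and x: "x = p \<oplus> m"
  shows "compl_proj H M x = p"
  unfolding compl_proj_def
proof (rule the_equality)
  show "p \<in> orth_compl H M \<and> (\<exists>m\<in>M. x = p \<oplus> m)"
    using bexI[where P="\<lambda>m. x = p \<oplus> m", OF x m] p by simp
  note subM = submoduleD[OF M]
  note subN = submoduleD[OF submodule_orth_compl[OF subM(1)]]
  fix p' assume "p' \<in> orth_compl H M \<and> (\<exists>m\<in>M. x = p' \<oplus> m)"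
  then obtain m' where p': "p' \<in> orth_compl H M" and m': "m' \<in> M" and x': "x = p' \<oplus> m'" by (elim conjE bexE)
  note * = p' m' trans[OF x[symmetric] x']
  have carr: "p \<in> carrier H" "p' \<in> carrier H" "m \<in> carrier H" "m' \<in> carrier H"
    using * p m subM(1) subN(1) by auto
  have ipeq: "ip H p z + ip H m z = ip H p' z + ip H m' z" if "z \<in> carrier H" for z
    using arg_cong[OF *(3), of "\<lambda>u. ip H u z"] that carr by (simp add: ip_add_left)
  have "p' \<ominus> p = m \<ominus> m'"
    using carr ipeq by (intro inner_extI) (auto simp: ip_minus_left algebra_simps)
  moreover have "p' \<ominus> p \<in> orth_compl H M" "m \<ominus> m' \<in> M" 
    using * p m subM(5) subN(5) by auto
  ultimately have "ip H (p' \<ominus> p) (p' \<ominus> p) = 0" using orth_complD(2) by metis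
  then show "p' = p" using ip_eq_zeroD[of "p' \<ominus> p"] carr by simp
qed

end

context complex_hilbert_space
begin

lemma complex_hilbert_space_orth_compl:
  assumes M: "M \<subseteq> carrier H"
  shows "complex_hilbert_space (H\<lparr>carrier := orth_compl H M\<rparr>)"
proof -
  let ?N = "orth_compl H M"
  note sub = submodule_orth_compl[OF M]
  interpret S: complex_inner_space "H\<lparr>carrier := ?N\<rparr>"
    by (rule complex_inner_space_submodule[OF sub])
  have carr: "x \<in> carrier H" if "x \<in> ?N" for x using that orth_complD by blast
  have "S.metric.mcomplete"
    unfolding S.mcomplete_iff_hnorm
  proof (intro allI impI)
    fix \<sigma> assume \<sigma>: "\<forall>n::nat. \<sigma> n \<in> carrier (H\<lparr>carrier := ?N\<rparr>)"
      and "\<forall>e>0. \<exists>N. \<forall>m\<ge>N. \<forall>n\<ge>N. hnorm (H\<lparr>carrier := ?N\<rparr>) (\<sigma> m \<ominus>\<^bsub>H\<lparr>carrier := ?N\<rparr>\<^esub> \<sigma> n) < e"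
    then have "\<forall>e>0. \<exists>N. \<forall>m\<ge>N. \<forall>n\<ge>N. hnorm H (\<sigma> m \<ominus> \<sigma> n) < e"
      using minus_submodule[OF sub] by simp
    moreover have "\<forall>n. \<sigma> n \<in> carrier H" using \<sigma> carr by simp
    ultimately obtain l where l: "l \<in> carrier H" and lim: "(\<lambda>n. hnorm H (\<sigma> n \<ominus> l)) \<longlonglongrightarrow> 0"
      using complete unfolding mcomplete_iff_hnorm by blast
    have "ip H l m = 0" if m: "m \<in> M" for m
    proof -
      have "(\<lambda>n. ip H (\<sigma> n) m) \<longlonglongrightarrow> ip H l m"
        using \<sigma> carr l M m lim by (intro ip_limit_left) auto
      moreover have "(\<lambda>n. ip H (\<sigma> n) m) = (\<lambda>n. 0)"
        using \<sigma> m by (auto simp: orth_compl_def)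
      ultimately show ?thesis using LIMSEQ_const_iff by metis
    qed
    then have "l \<in> ?N" using l by (simp add: orth_compl_def)
    then show "\<exists>l\<in>carrier (H\<lparr>carrier := ?N\<rparr>). 
        (\<lambda>n. hnorm (H\<lparr>carrier := ?N\<rparr>) (\<sigma> n \<ominus>\<^bsub>H\<lparr>carrier := ?N\<rparr>\<^esub> l)) \<longlonglongrightarrow> 0"
      using lim \<sigma> minus_submodule[OF sub] by (intro bexI[of _ l]) simp_all
  qed
  then show ?thesis by unfold_locales
qed

end

locale closed_subspace_of_hilbert = complex_hilbert_space +
  fixes M
  assumes closed: "closed_subspace H M"
begin

abbreviation P where "P \<equiv> compl_proj H M"
abbreviation N where "N \<equiv> orth_compl H M"

lemma subM: "submodule M cring_class_ops H" using closed by (simp add: closed_subspace_def)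

lemma M_carrier: "m \<in> M \<Longrightarrow> m \<in> carrier H" using submoduleD(1)[OF subM] by blast

lemma subN: "submodule N cring_class_ops H"
  using submodule_orth_compl[OF submoduleD(1)[OF subM]] .

lemma N_carrier: "p \<in> N \<Longrightarrow> p \<in> carrier H" by (rule orth_complD)

text \<open>
  The component in \<open>M\<close> is the nearest point \<open>q\<close> of \<open>M\<close>; since \<open>q\<close> is optimal among all \<open>q + a m\<close>, the
  difference \<open>x - q\<close> is orthogonal to every \<open>m\<close>.
\<close>

lemma orth_decomposition:
  assumes x: "x \<in> carrier H"
  obtains p m where "p \<in> N" "m \<in> M" "x = p \<oplus> m" "P x = p"
proof -
  obtain q where q: "q \<in> M" and min: "\<And>m. m \<in> M \<Longrightarrow> hnorm H (x \<ominus> q) \<le> hnorm H (x \<ominus> m)"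
    using ex_nearest_point[OF closed x] by blast
  have qc: "q \<in> carrier H" using M_carrier[OF q] .
  have "ip H (x \<ominus> q) m = 0" if m: "m \<in> M" for m
  proof (rule nearest_point_orthogonal)
    fix a
    have "x \<ominus> q \<ominus> a \<odot> m = x \<ominus> (q \<oplus> a \<odot> m)"
      using x qc M_carrier[OF m] by (intro inner_extI) (auto simp: ip_simps)
    moreover have "q \<oplus> a \<odot> m \<in> M" using q m submoduleD[OF subM] by blast
    ultimately show "hnorm H (x \<ominus> q) \<le> hnorm H (x \<ominus> q \<ominus> a \<odot> m)"
      using min by simp
  qed (use x qc M_carrier[OF m] in auto)
  then have "x \<ominus> q \<in> N" using x qc by (simp add: orth_compl_def)
  moreover have "x = (x \<ominus> q) \<oplus> q"
    using x qc by (intro inner_extI) (auto simp: ip_simps)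
  ultimately show thesis using that q compl_proj_eqI[OF subM] by metis
qed

lemma P_in_N [simp]: "x \<in> carrier H \<Longrightarrow> P x \<in> N"
  by (metis orth_decomposition)

lemma P_of_N [simp]: "x \<in> N \<Longrightarrow> P x = x"
  using compl_proj_eqI[OF subM, of x \<zero> x] submoduleD(2)[OF subM] N_carrier by simp

lemma P_eq_zero_iff: "x \<in> carrier H \<Longrightarrow> P x = \<zero> \<longleftrightarrow> x \<in> M"
proof
  assume "x \<in> carrier H" "P x = \<zero>"
  then show "x \<in> M" using orth_decomposition M_carrier by (metis M.l_zero)
next
  assume "x \<in> carrier H" "x \<in> M"
  then show "P x = \<zero>" 
    using compl_proj_eqI[OF subM, of \<zero> x x] submoduleD(2)[OF subN] by simp
qed

lemma P_add: 
  assumes x: "x \<in> carrier H" and y: "y \<in> carrier H" 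
  shows "P (x \<oplus> y) = P x \<oplus> P y"
proof -
  obtain p m where 1: "p \<in> N" "m \<in> M" "x = p \<oplus> m" "P x = p" using orth_decomposition[OF x] .
  obtain q n where 2: "q \<in> N" "n \<in> M" "y = q \<oplus> n" "P y = q" using orth_decomposition[OF y] .
  have "x \<oplus> y = (p \<oplus> q) \<oplus> (m \<oplus> n)"
    using 1 2 M_carrier N_carrier by (simp add: M.a_ac)
  then show ?thesis
    using 1 2 submoduleD[OF subM] submoduleD[OF subN] compl_proj_eqI[OF subM] by simp
qed

lemma P_smult:
  assumes x: "x \<in> carrier H" 
  shows "P (a \<odot> x) = a \<odot> P x"
proof -
  obtain p m where 1: "p \<in> N" "m \<in> M" "x = p \<oplus> m" "P x = p" using orth_decomposition[OF x] .
  have "a \<odot> x = a \<odot> p \<oplus> a \<odot> m"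
    using 1 M_carrier N_carrier by (simp add: smult_r_distr carrier_class)
  then show ?thesis
    using 1 submoduleD[OF subM] submoduleD[OF subN] compl_proj_eqI[OF subM] by simp
qed

lemma P_minus:
  "\<lbrakk>x \<in> carrier H; y \<in> carrier H\<rbrakk> \<Longrightarrow> P (x \<ominus> y) = P x \<ominus> P y"
  using N_carrier by (simp add: minus_eq_smult P_add P_smult)

lemma P_finsum:
  assumes "finite A" "\<And>a. a \<in> A \<Longrightarrow> f a \<in> carrier H"
  shows "P (finsum H f A) = finsum H (\<lambda>a. P (f a)) A"
  using assms
proof (induction rule: finite_induct)
  case empty
  then show ?case using submoduleD(2)[OF subN] by simp
next
  case (insert a A)
  then have "f \<in> A \<rightarrow> carrier H" "(\<lambda>a. P (f a)) \<in> A \<rightarrow> carrier H" using N_carrier by auto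
  then show ?case using insert N_carrier by (simp add: P_add)
qed

lemma P_cong_mod_M:
  assumes x: "x \<in> carrier H" and y: "y \<in> carrier H" and "x \<ominus> y \<in> M"
  shows "P x = P y"
proof -
  have "P x \<ominus> P y = \<zero>"
    using assms by (simp flip: P_minus add: P_eq_zero_iff)
  then show ?thesis using x y N_carrier by simp
qed

lemma minus_P_in_M: 
  assumes "x \<in> carrier H" shows "x \<ominus> P x \<in> M"
proof -
  have "P (x \<ominus> P x) = \<zero>" using assms N_carrier[of "P x"] by (simp add: P_minus)
  then show ?thesis using assms N_carrier[of "P x"] by (simp add: P_eq_zero_iff)
qed

lemma ip_P:
  assumes x: "x \<in> carrier H" and y: "y \<in> N"
  shows "ip H (P x) y = ip H x y"
proof -
  obtain p m where 1: "p \<in> N" "m \<in> M" "x = p \<oplus> m" "P x = p" using orth_decomposition[OF x] .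
  then have "ip H y m = 0" using y orth_complD(2) by blast
  then have "ip H m y = 0" using ip_commute[of y m] 1 y M_carrier N_carrier by simp
  then show ?thesis using 1 y M_carrier N_carrier by (simp add: ip_add_left)
qed

lemma hnorm_P_le:
  assumes x: "x \<in> carrier H"
  shows "hnorm H (P x) \<le> hnorm H x"
proof -
  obtain p m where 1: "p \<in> N" "m \<in> M" "x = p \<oplus> m" "P x = p" using orth_decomposition[OF x] .
  then have "ip H p m = 0" using orth_complD(2) by blast
  then have "(hnorm H p)\<^sup>2 \<le> (hnorm H x)\<^sup>2"
    using 1 M_carrier N_carrier by (simp add: hnorm_add_sq)
  then have "hnorm H p \<le> hnorm H x" by (rule power2_le_imp_le) (use x in simp)
  then show ?thesis using 1 by simp
qed

end

section \<open>The Hilbert space of square summable series\<close>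

locale coefficient_space = complex_hilbert_space Y for Y :: "'y hilbert" (structure)
begin

lemma H2_simps [simp]:
  "zero (H2 Y) = (\<lambda>v. \<zero>)"
  "add (H2 Y) f g = (\<lambda>v. f v \<oplus> g v)"
  "smult (H2 Y) a f = (\<lambda>v. a \<odot> f v)"
  by (simp_all add: H2_def)

lemma ip_H2: "ip (H2 Y) f g = (\<Sum>\<^sub>\<infinity>v. ip Y (f v) (g v))"
  by (simp add: H2_def)

lemma carrier_H2_iff:
  "f \<in> carrier (H2 Y) \<longleftrightarrow> (\<forall>v. f v \<in> carrier Y) \<and> (\<lambda>v. (hnorm Y (f v))\<^sup>2) summable_on UNIV"
  by (simp add: H2_def)

lemma H2D:
  assumes "f \<in> carrier (H2 Y)"
  shows "f v \<in> carrier Y" "(\<lambda>v. (hnorm Y (f v))\<^sup>2) summable_on A"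
  using assms summable_on_subset by (auto simp: carrier_H2_iff)

lemma H2I:
  assumes "\<And>v. f v \<in> carrier Y" "g summable_on UNIV" "\<And>v. (hnorm Y (f v))\<^sup>2 \<le> g v"
  shows "f \<in> carrier (H2 Y)"
  unfolding carrier_H2_iff 
  using assms by (auto intro: summable_on_comparison_test[of g])

lemma H2_zero_closed: "(\<lambda>v. \<zero>) \<in> carrier (H2 Y)"
  by (rule H2I[of _ "\<lambda>_. 0"]) auto

lemma H2_smult_closed:
  assumes "f \<in> carrier (H2 Y)"
  shows "(\<lambda>v. a \<odot> f v) \<in> carrier (H2 Y)"
  by (rule H2I[of _ "\<lambda>v. (cmod a)\<^sup>2 * (hnorm Y (f v))\<^sup>2"])
    (use H2D[OF assms] in \<open>auto simp: hnorm_smult power_mult_distrib intro: summable_on_cmult_right\<close>)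

text \<open>The parallelogram identity gives \<open>\<parallel>a + b\<parallel>\<^sup>2 \<le> 2 \<parallel>a\<parallel>\<^sup>2 + 2 \<parallel>b\<parallel>\<^sup>2\<close> in each coefficient.\<close>

lemma H2_add_closed:
  assumes f: "f \<in> carrier (H2 Y)" and g: "g \<in> carrier (H2 Y)"
  shows "(\<lambda>v. f v \<oplus> g v) \<in> carrier (H2 Y)"
proof (rule H2I[of _ "\<lambda>v. 2 * (hnorm Y (f v))\<^sup>2 + 2 * (hnorm Y (g v))\<^sup>2"])
  show "(\<lambda>v. 2 * (hnorm Y (f v))\<^sup>2 + 2 * (hnorm Y (g v))\<^sup>2) summable_on UNIV"
    by (intro summable_on_add summable_on_cmult_right H2D f g)
  fix v
  have "(hnorm Y (f v \<oplus> g v))\<^sup>2 + (hnorm Y (f v \<ominus> g v))\<^sup>2 = 2 * (hnorm Y (f v))\<^sup>2 + 2 * (hnorm Y (g v))\<^sup>2"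
    using H2D(1)[OF f, of v] H2D(1)[OF g, of v] by (simp add: hnorm_add_sq hnorm_diff_sq)
  moreover have "0 \<le> (hnorm Y (f v \<ominus> g v))\<^sup>2" by (rule zero_le_power2)
  ultimately show "(hnorm Y (f v \<oplus> g v))\<^sup>2 \<le> 2 * (hnorm Y (f v))\<^sup>2 + 2 * (hnorm Y (g v))\<^sup>2"
    by linarith
qed (use H2D[OF f] H2D[OF g] in auto)

text \<open>By Cauchy--Schwarz the terms are dominated by \<open>\<parallel>f\<^sub>v\<parallel>\<^sup>2 + \<parallel>g\<^sub>v\<parallel>\<^sup>2\<close>.\<close>

lemma ip_summable:
  assumes f: "f \<in> carrier (H2 Y)" and g: "g \<in> carrier (H2 Y)"
  shows "(\<lambda>v. ip Y (f v) (g v)) summable_on A"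
proof -
  have "(\<lambda>v. norm (ip Y (f v) (g v))) summable_on UNIV"
  proof (rule summable_on_comparison_test)
    show "(\<lambda>v. (hnorm Y (f v))\<^sup>2 + (hnorm Y (g v))\<^sup>2) summable_on UNIV"
      by (intro summable_on_add H2D f g)
    fix v
    have "cmod (ip Y (f v) (g v)) \<le> hnorm Y (f v) * hnorm Y (g v)"
      using H2D(1)[OF f] H2D(1)[OF g] by (rule Cauchy_Schwarz)
    moreover have "2 * (hnorm Y (f v) * hnorm Y (g v)) \<le> (hnorm Y (f v))\<^sup>2 + (hnorm Y (g v))\<^sup>2"
      using sum_squares_bound[of "hnorm Y (f v)" "hnorm Y (g v)"] by simp
    moreover have "0 \<le> hnorm Y (f v) * hnorm Y (g v)" 
      using H2D(1)[OF f] H2D(1)[OF g] by simp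
    ultimately show "norm (ip Y (f v) (g v)) \<le> (hnorm Y (f v))\<^sup>2 + (hnorm Y (g v))\<^sup>2"
      by linarith
  qed simp
  then have "(\<lambda>v. ip Y (f v) (g v)) summable_on UNIV"
    by (rule Infinite_Sum.abs_summable_summable)
  then show ?thesis by (rule summable_on_subset) simp
qed

lemma abelian_group_H2: "abelian_group (H2 Y)"
proof (rule abelian_groupI)
  fix f assume f: "f \<in> carrier (H2 Y)"
  have "(-1) \<odot> f v \<oplus> f v = \<zero>" for v
    using H2D(1)[OF f, of v] by (intro inner_extI) (auto simp: ip_simps)
  then show "\<exists>g\<in>carrier (H2 Y). g \<oplus>\<^bsub>H2 Y\<^esub> f = \<zero>\<^bsub>H2 Y\<^esub>"
    by (intro bexI[of _ "\<lambda>v. (-1) \<odot> f v"] H2_smult_closed f) simp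
qed (auto simp: H2_zero_closed H2_add_closed H2D M.a_ac fun_eq_iff)

lemma module_H2: "Module.module cring_class_ops (H2 Y)"
  by (rule moduleI[OF cring_class abelian_group_H2])
    (auto simp: H2_smult_closed H2D smult_add_left smult_r_distr smult_mult class_simps)

lemma complex_inner_space_H2: "complex_inner_space (H2 Y)"
proof -
  interpret Module.module "cring_class_ops :: complex ring" "H2 Y" by (rule module_H2)
  show ?thesis
  proof
    fix f g h :: "'a list \<Rightarrow> 'y" and a
    assume f: "f \<in> carrier (H2 Y)"
    have "ip Y (f v) (f v) = of_real ((hnorm Y (f v))\<^sup>2)" for v
      using H2D(1)[OF f] by (rule ip_self)
    then have self: "ip (H2 Y) f f = of_real (\<Sum>\<^sub>\<infinity>v. (hnorm Y (f v))\<^sup>2)"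
      unfolding ip_H2 by (simp add: infsumI[OF has_sum_of_real[OF has_sum_infsum[OF H2D(2)[OF f, of UNIV]]]] del: of_real_power)
    have nonneg: "0 \<le> (\<Sum>\<^sub>\<infinity>v. (hnorm Y (f v))\<^sup>2)" by (rule infsum_nonneg) simp
    then show "0 \<le> Re (ip (H2 Y) f f)" by (simp add: self)
    show "f = \<zero>\<^bsub>H2 Y\<^esub>" if "ip (H2 Y) f f = 0"
    proof
      fix v
      have "(hnorm Y (f v))\<^sup>2 = 0"
        by (rule nonneg_infsum_le_0D[OF _ H2D(2)[OF f, of UNIV]]) (use that self in auto)
      then show "f v = \<zero>\<^bsub>H2 Y\<^esub> v" using H2D(1)[OF f] by (simp add: hnorm_eq_0D)
    qed
    assume g: "g \<in> carrier (H2 Y)"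
    show "ip (H2 Y) (a \<odot>\<^bsub>H2 Y\<^esub> f) g = a * ip (H2 Y) f g"
      using H2D(1)[OF f] H2D(1)[OF g] by (simp add: ip_H2 ip_smult_left infsum_cmult_right')
    have "ip Y (g v) (f v) = cnj (ip Y (f v) (g v))" for v
      using H2D(1)[OF f] H2D(1)[OF g] by (rule ip_commute)
    then show "ip (H2 Y) g f = cnj (ip (H2 Y) f g)" by (simp add: ip_H2)
    assume h: "h \<in> carrier (H2 Y)"
    show "ip (H2 Y) (f \<oplus>\<^bsub>H2 Y\<^esub> g) h = ip (H2 Y) f h + ip (H2 Y) g h"
      using H2D(1)[OF f] H2D(1)[OF g] H2D(1)[OF h] ip_summable[OF f h] ip_summable[OF g h]
      by (simp add: ip_H2 ip_add_left infsum_add)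
  qed
qed

end

sublocale coefficient_space \<subseteq> K: complex_inner_space "H2 Y"
  by (rule complex_inner_space_H2)

context coefficient_space
begin

lemma minus_H2:
  assumes "f \<in> carrier (H2 Y)" "g \<in> carrier (H2 Y)"
  shows "f \<ominus>\<^bsub>H2 Y\<^esub> g = (\<lambda>v. f v \<ominus> g v)"
  using assms H2D(1)[OF assms(1)] H2D(1)[OF assms(2)] by (simp add: K.minus_eq_smult minus_eq_smult)

lemma hnorm_H2_sq:
  assumes f: "f \<in> carrier (H2 Y)"
  shows "(hnorm (H2 Y) f)\<^sup>2 = (\<Sum>\<^sub>\<infinity>v. (hnorm Y (f v))\<^sup>2)"
proof -
  have "(hnorm (H2 Y) f)\<^sup>2 = (\<Sum>\<^sub>\<infinity>v. Re (ip Y (f v) (f v)))"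
    using K.hnorm_sq[OF f] infsum_Re[OF ip_summable[OF f f, of UNIV]] by (simp add: ip_H2)
  then show ?thesis using H2D(1)[OF f] by (simp add: hnorm_sq)
qed

lemma sum_le_hnorm_H2:
  assumes f: "f \<in> carrier (H2 Y)" and "finite F"
  shows "(\<Sum>v\<in>F. (hnorm Y (f v))\<^sup>2) \<le> (hnorm (H2 Y) f)\<^sup>2"
  unfolding hnorm_H2_sq[OF f] using assms H2D(2)[OF f] by (intro finite_sum_le_infsum) auto

lemma coeff_le_hnorm_H2:
  assumes f: "f \<in> carrier (H2 Y)"
  shows "hnorm Y (f v) \<le> hnorm (H2 Y) f"
proof (rule power2_le_imp_le)
  show "(hnorm Y (f v))\<^sup>2 \<le> (hnorm (H2 Y) f)\<^sup>2" using sum_le_hnorm_H2[OF f, of "{v}"] by simp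
qed (use f in simp)

text \<open>
  A Cauchy sequence converges in each coefficient. The Cauchy estimate, restricted to finitely many
  coefficients, survives the passage to the limit in one index; since the bound is independent of the
  finite set, it holds for the whole difference with the coefficientwise limit.
\<close>

lemma complex_hilbert_space_H2: "complex_hilbert_space (H2 Y :: ('d::finite list \<Rightarrow> 'y) hilbert)"
proof
  show "Metric_space.mcomplete (carrier (H2 Y)) (hdist (H2 Y :: ('d list \<Rightarrow> 'y) hilbert))"
    unfolding K.mcomplete_iff_hnorm
  proof (intro allI impI)
    fix \<sigma> :: "nat \<Rightarrow> 'd list \<Rightarrow> 'y"
    assume \<sigma>: "\<forall>n. \<sigma> n \<in> carrier (H2 Y)"
      and Cauchy: "\<forall>e>0. \<exists>N. \<forall>m\<ge>N. \<forall>n\<ge>N. hnorm (H2 Y) (\<sigma> m \<ominus>\<^bsub>H2 Y\<^esub> \<sigma> n) < e"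
    have \<sigma>v: "\<sigma> n v \<in> carrier Y" for n v using \<sigma> H2D(1) by blast
    have diff: "\<sigma> m \<ominus>\<^bsub>H2 Y\<^esub> \<sigma> n \<in> carrier (H2 Y)" for m n using \<sigma> by simp
    have diffv: "(\<sigma> m \<ominus>\<^bsub>H2 Y\<^esub> \<sigma> n) v = \<sigma> m v \<ominus> \<sigma> n v" for m n v using \<sigma> by (simp add: minus_H2)
    have "\<exists>l\<in>carrier Y. (\<lambda>n. hnorm Y (\<sigma> n v \<ominus> l)) \<longlonglongrightarrow> 0" for v
    proof -
      have "hnorm Y (\<sigma> m v \<ominus> \<sigma> n v) \<le> hnorm (H2 Y) (\<sigma> m \<ominus>\<^bsub>H2 Y\<^esub> \<sigma> n)" for m n
        using coeff_le_hnorm_H2[OF diff, of m n v] by (simp add: diffv)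
      then have "\<forall>e>0. \<exists>N. \<forall>m\<ge>N. \<forall>n\<ge>N. hnorm Y (\<sigma> m v \<ominus> \<sigma> n v) < e"
        using Cauchy by (meson le_less_trans)
      then show ?thesis
        using complete[unfolded mcomplete_iff_hnorm, rule_format, of "\<lambda>n. \<sigma> n v"] \<sigma>v by blast
    qed
    then obtain f where f: "\<And>v. f v \<in> carrier Y" and lim: "\<And>v. (\<lambda>n. hnorm Y (\<sigma> n v \<ominus> f v)) \<longlonglongrightarrow> 0"
      by metis
    have lim2: "(\<lambda>n. hnorm Y (\<sigma> m v \<ominus> \<sigma> n v)) \<longlonglongrightarrow> hnorm Y (\<sigma> m v \<ominus> f v)" for m v
    proof -
      have "\<bar>hnorm Y (\<sigma> m v \<ominus> \<sigma> n v) - hnorm Y (\<sigma> m v \<ominus> f v)\<bar> \<le> hnorm Y (\<sigma> n v \<ominus> f v)" for n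
        using hnorm_triangle_minus[of "\<sigma> m v" "\<sigma> n v" "f v"] 
          hnorm_triangle_minus[of "\<sigma> m v" "f v" "\<sigma> n v"] hnorm_minus_commute[of "\<sigma> n v" "f v"] \<sigma>v f
        by fastforce
      then have "(\<lambda>n. hnorm Y (\<sigma> m v \<ominus> \<sigma> n v) - hnorm Y (\<sigma> m v \<ominus> f v)) \<longlonglongrightarrow> 0"
        by (intro Lim_null_comparison[OF always_eventually lim[of v]]) simp
      then show ?thesis using Lim_null by blast
    qed
    \<comment> \<open>This gives at once that the limit is square summable and that it is a limit in norm.\<close>
    have tail: "\<exists>N. \<forall>m\<ge>N. (\<lambda>v. \<sigma> m v \<ominus> f v) \<in> carrier (H2 Y) \<and> 
        hnorm (H2 Y) (\<lambda>v. \<sigma> m v \<ominus> f v) \<le> e" if "e > 0" for e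
    proof -
      obtain N where N: "\<And>m n. \<lbrakk>m \<ge> N; n \<ge> N\<rbrakk> \<Longrightarrow> hnorm (H2 Y) (\<sigma> m \<ominus>\<^bsub>H2 Y\<^esub> \<sigma> n) < e"
        using Cauchy \<open>e > 0\<close> by meson
      have "(\<lambda>v. \<sigma> m v \<ominus> f v) \<in> carrier (H2 Y) \<and> hnorm (H2 Y) (\<lambda>v. \<sigma> m v \<ominus> f v) \<le> e"
        if m: "m \<ge> N" for m
      proof -
        have fin: "(\<Sum>v\<in>F. (hnorm Y (\<sigma> m v \<ominus> f v))\<^sup>2) \<le> e\<^sup>2" if "finite F" for F
        proof (rule LIMSEQ_le_const2)
          show "(\<lambda>n. \<Sum>v\<in>F. (hnorm Y (\<sigma> m v \<ominus> \<sigma> n v))\<^sup>2) \<longlonglongrightarrow> (\<Sum>v\<in>F. (hnorm Y (\<sigma> m v \<ominus> f v))\<^sup>2)"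
            by (intro tendsto_sum tendsto_power lim2)
          have "(\<Sum>v\<in>F. (hnorm Y (\<sigma> m v \<ominus> \<sigma> n v))\<^sup>2) \<le> e\<^sup>2" if n: "n \<ge> N" for n
          proof -
            have "(\<Sum>v\<in>F. (hnorm Y (\<sigma> m v \<ominus> \<sigma> n v))\<^sup>2) \<le> (hnorm (H2 Y) (\<sigma> m \<ominus>\<^bsub>H2 Y\<^esub> \<sigma> n))\<^sup>2"
              using sum_le_hnorm_H2[OF diff \<open>finite F\<close>, of m n] by (simp add: diffv)
            also have "\<dots> \<le> e\<^sup>2" using N[OF m n] diff by (intro power_mono) auto
            finally show ?thesis .
          qed
          then show "\<exists>N. \<forall>n\<ge>N. (\<Sum>v\<in>F. (hnorm Y (\<sigma> m v \<ominus> \<sigma> n v))\<^sup>2) \<le> e\<^sup>2" by blast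
        qed
        have summ: "(\<lambda>v. (hnorm Y (\<sigma> m v \<ominus> f v))\<^sup>2) summable_on UNIV"
          by (rule nonneg_bounded_partial_sums_imp_summable_on[where C = "e\<^sup>2"])
            (auto intro!: eventually_finite_subsets_at_top_weakI fin)
        then have carr: "(\<lambda>v. \<sigma> m v \<ominus> f v) \<in> carrier (H2 Y)"
          using \<sigma>v f by (simp add: carrier_H2_iff)
        moreover have "(hnorm (H2 Y) (\<lambda>v. \<sigma> m v \<ominus> f v))\<^sup>2 \<le> e\<^sup>2"
          unfolding hnorm_H2_sq[OF carr] using summ fin by (rule infsum_le_finite_sums) 
        then have "hnorm (H2 Y) (\<lambda>v. \<sigma> m v \<ominus> f v) \<le> e"
          by (rule power2_le_imp_le) (use \<open>e > 0\<close> in simp)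
        ultimately show ?thesis by blast
      qed
      then show ?thesis by blast
    qed
    have fK: "f \<in> carrier (H2 Y)"
    proof -
      obtain m where m: "(\<lambda>v. \<sigma> m v \<ominus> f v) \<in> carrier (H2 Y)" using tail[of 1] by auto
      have "f = (\<lambda>v. \<sigma> m v \<oplus> (-1) \<odot> (\<sigma> m v \<ominus> f v))"
      proof
        fix v show "f v = \<sigma> m v \<oplus> (-1) \<odot> (\<sigma> m v \<ominus> f v)"
          using \<sigma>v[of m v] f[of v] by (intro inner_extI) (auto simp: ip_simps)
      qed
      also have "\<dots> \<in> carrier (H2 Y)"
        using \<sigma> by (intro H2_add_closed H2_smult_closed m) blast
      finally show ?thesis .
    qed
    have "\<exists>N. \<forall>m\<ge>N. norm (hnorm (H2 Y) (\<sigma> m \<ominus>\<^bsub>H2 Y\<^esub> f) - 0) < e" if "e > 0" for e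
    proof -
      obtain N where "\<forall>m\<ge>N. hnorm (H2 Y) (\<lambda>v. \<sigma> m v \<ominus> f v) \<le> e / 2"
        using tail[of "e/2"] \<open>e > 0\<close> by auto
      moreover have "\<sigma> m \<ominus>\<^bsub>H2 Y\<^esub> f = (\<lambda>v. \<sigma> m v \<ominus> f v)" "0 \<le> hnorm (H2 Y) (\<sigma> m \<ominus>\<^bsub>H2 Y\<^esub> f)" for m
        using \<sigma> fK by (simp add: minus_H2, simp)
      ultimately have "norm (hnorm (H2 Y) (\<sigma> m \<ominus>\<^bsub>H2 Y\<^esub> f) - 0) < e" if "m \<ge> N" for m
        using that \<open>e > 0\<close> by fastforce
      then show ?thesis by blast
    qed
    then have "(\<lambda>n. hnorm (H2 Y) (\<sigma> n \<ominus>\<^bsub>H2 Y\<^esub> f)) \<longlonglongrightarrow> 0"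
      by (intro LIMSEQ_I) blast
    then show "\<exists>l\<in>carrier (H2 Y). (\<lambda>n. hnorm (H2 Y) (\<sigma> n \<ominus>\<^bsub>H2 Y\<^esub> l)) \<longlonglongrightarrow> 0"
      using fK by blast
  qed
qed

end

section \<open>Shifts, backward shifts and restrictions\<close>

text \<open>The adjoint of the right shift by \<open>j\<close>; see \<open>ip_shift\<close>.\<close>

definition backshift :: "'d \<Rightarrow> ('d list \<Rightarrow> 'y) \<Rightarrow> 'd list \<Rightarrow> 'y"
  where "backshift j f = (\<lambda>w. f (w @ [j]))"

context coefficient_space
begin

text \<open>
  Partial sums of a series, its constant term and the components in the ranges of the shifts all arise
  by cutting the series down to a set of words, so that one summation lemma, \<open>finsum_restr\<close>, serves
  them all.
\<close>

definition restr :: "'d list set \<Rightarrow> ('d list \<Rightarrow> 'y) \<Rightarrow> 'd list \<Rightarrow> 'y"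
  where "restr S f = (\<lambda>w. if w \<in> S then f w else \<zero>)"

definition monom_H2 :: "'d list \<Rightarrow> 'y \<Rightarrow> 'd list \<Rightarrow> 'y"
  where "monom_H2 v y = restr {v} (\<lambda>_. y)"

lemma restr_closed:
  assumes f: "f \<in> carrier (H2 Y)"
  shows "restr S f \<in> carrier (H2 Y)"
  by (rule H2I[of _ "\<lambda>v. (hnorm Y (f v))\<^sup>2"]) (use H2D[OF f] in \<open>auto simp: restr_def\<close>)

lemma hnorm_restr_sq:
  assumes f: "f \<in> carrier (H2 Y)"
  shows "(hnorm (H2 Y) (restr S f))\<^sup>2 = (\<Sum>\<^sub>\<infinity>v\<in>S. (hnorm Y (f v))\<^sup>2)"
  unfolding hnorm_H2_sq[OF restr_closed[OF f]] 
  by (rule infsum_cong_neutral) (auto simp: restr_def)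

lemma minus_restr:
  assumes f: "f \<in> carrier (H2 Y)"
  shows "f \<ominus>\<^bsub>H2 Y\<^esub> restr S f = restr (- S) f"
  using H2D(1)[OF f] M.r_neg unfolding minus_H2[OF f restr_closed[OF f]]
  by (auto simp: restr_def a_minus_def)

text \<open>
  Applied to singletons this computes the partial sums of \<open>f = \<Sum>\<^sub>v f\<^sub>v z\<^sup>v\<close>; applied to the sets of words
  with a given last letter it computes \<open>\<Sum>\<^sub>j S\<^sub>j S\<^sub>j\<^sup>* f\<close>.
\<close>

lemma finsum_restr:
  assumes f: "f \<in> carrier (H2 Y)" and "finite A" and disj: "disjoint_family_on S A"
  shows "finsum (H2 Y) (\<lambda>a. restr (S a) f) A = restr (\<Union>a\<in>A. S a) f"
  using assms(2,3)
proof (induction rule: finite_induct)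
  case empty
  then show ?case using K.M.finsum_empty[of "\<lambda>a. restr (S a) f"] by (simp add: restr_def)
next
  case (insert a A)
  then have "disjoint_family_on S A" "S a \<inter> (\<Union>b\<in>A. S b) = {}"
    unfolding disjoint_family_on_def by auto
  then show ?case
    using insert K.M.finsum_insert[of A a "\<lambda>a. restr (S a) f"] restr_closed[OF f] H2D(1)[OF f]
    by (auto simp: Pi_def restr_def fun_eq_iff)
qed

lemma monom_closed:
  assumes "y \<in> carrier Y"
  shows "monom_H2 v y \<in> carrier (H2 Y)"
proof (rule H2I)
  show "(\<lambda>w. if w = v then (hnorm Y y)\<^sup>2 else 0) summable_on UNIV"
    by (rule finite_nonzero_values_imp_summable_on) simp
qed (use assms in \<open>auto simp: monom_H2_def restr_def\<close>)

lemma monom_coeff: "monom_H2 v (f v) = restr {v} f"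
  by (auto simp: monom_H2_def restr_def)

lemma ip_monom:
  assumes y: "y \<in> carrier Y" and f: "f \<in> carrier (H2 Y)"
  shows "ip (H2 Y) (monom_H2 v y) f = ip Y y (f v)"
proof -
  have "ip (H2 Y) (monom_H2 v y) f = (\<Sum>\<^sub>\<infinity>w\<in>{v}. ip Y (monom_H2 v y w) (f w))"
    unfolding ip_H2 using H2D(1)[OF f]
    by (intro infsum_cong_neutral) (auto simp: monom_H2_def restr_def ip_zero_left)
  then show ?thesis by (simp add: monom_H2_def restr_def)
qed

lemma hnorm_monom:
  assumes y: "y \<in> carrier Y"
  shows "hnorm (H2 Y) (monom_H2 v y) = hnorm Y y"
  using ip_monom[OF y monom_closed[OF y], of v v] by (simp add: hnorm_def monom_H2_def restr_def)

lemma inj_snoc: "inj_on (\<lambda>w. w @ [j]) A"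
  by (auto simp: inj_on_def)

lemma backshift_closed:
  assumes f: "f \<in> carrier (H2 Y)"
  shows "backshift j f \<in> carrier (H2 Y)"
proof -
  have "(\<lambda>v. (hnorm Y (f v))\<^sup>2) \<circ> (\<lambda>w. w @ [j]) summable_on UNIV"
    using summable_on_reindex[OF inj_snoc[of j UNIV], of "\<lambda>v. (hnorm Y (f v))\<^sup>2"] H2D(2)[OF f] by blast
  then show ?thesis
    using H2D(1)[OF f] by (simp add: carrier_H2_iff backshift_def o_def)
qed

lemma shift_snoc: "shift Y j f (w @ [i]) = (if i = j then f w else \<zero>)"
  by (simp add: shift_def)

lemma shift_outside: "w \<notin> range (\<lambda>w. w @ [j]) \<Longrightarrow> shift Y j f w = \<zero>"
  by (auto simp: shift_def image_def) (metis append_butlast_last_id)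

lemma infsum_shift:
  assumes "\<And>w. w \<notin> range (\<lambda>w. w @ [j]) \<Longrightarrow> h w = 0"
  shows "infsum h UNIV = (\<Sum>\<^sub>\<infinity>w. h (w @ [j]))"
proof -
  have "infsum h UNIV = infsum h (range (\<lambda>w. w @ [j]))"
    using assms by (intro infsum_cong_neutral) auto
  also have "\<dots> = (\<Sum>\<^sub>\<infinity>w. h (w @ [j]))"
    by (subst infsum_reindex) (auto simp: inj_snoc o_def)
  finally show ?thesis .
qed

lemma shift_closed:
  assumes f: "f \<in> carrier (H2 Y)"
  shows "shift Y j f \<in> carrier (H2 Y)"
proof -
  have "(\<lambda>v. (hnorm Y (shift Y j f v))\<^sup>2) summable_on UNIV \<longleftrightarrow> 
     (\<lambda>v. (hnorm Y (shift Y j f v))\<^sup>2) summable_on range (\<lambda>w. w @ [j])"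
    by (rule summable_on_cong_neutral) (auto simp: shift_outside)
  also have "\<dots>"
    by (subst summable_on_reindex) (use H2D(2)[OF f] in \<open>auto simp: inj_snoc o_def shift_snoc\<close>)
  finally show ?thesis using H2D(1)[OF f] by (simp add: carrier_H2_iff shift_def)
qed

lemma ip_shift:
  assumes f: "f \<in> carrier (H2 Y)" and g: "g \<in> carrier (H2 Y)"
  shows "ip (H2 Y) (shift Y j f) g = ip (H2 Y) f (backshift j g)"
proof -
  have "ip (H2 Y) (shift Y j f) g = (\<Sum>\<^sub>\<infinity>w. ip Y (shift Y j f (w @ [j])) (g (w @ [j])))"
    unfolding ip_H2 using H2D(1)[OF g] by (intro infsum_shift) (simp add: shift_outside ip_zero_left)
  then show ?thesis by (simp add: ip_H2 shift_snoc backshift_def)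
qed

lemma backshift_shift: "backshift j (shift Y j f) = f"
  by (simp add: backshift_def shift_snoc)

lemma shift_backshift: "shift Y j (backshift j f) = restr {w. w \<noteq> [] \<and> last w = j} f"
proof
  fix w show "shift Y j (backshift j f) w = restr {w. w \<noteq> [] \<and> last w = j} f w"
    by (cases w rule: rev_cases) (auto simp: shift_def backshift_def restr_def)
qed

lemma hnorm_shift:
  assumes f: "f \<in> carrier (H2 Y)"
  shows "hnorm (H2 Y) (shift Y j f) = hnorm (H2 Y) f"
  using ip_shift[OF f shift_closed[OF f], of j j] by (simp add: hnorm_def backshift_shift)

lemma shift_add:
  "shift Y j (\<lambda>v. f v \<oplus> g v) = (\<lambda>v. shift Y j f v \<oplus> shift Y j g v)"
  by (auto simp: shift_def)

lemma shift_smult: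
  "shift Y j (\<lambda>v. a \<odot> f v) = (\<lambda>v. a \<odot> shift Y j f v)"
  using smult_r_null[of a] by (auto simp: shift_def carrier_class)

lemma shift_minus:
  assumes "f \<in> carrier (H2 Y)" "g \<in> carrier (H2 Y)"
  shows "shift Y j (f \<ominus>\<^bsub>H2 Y\<^esub> g) = shift Y j f \<ominus>\<^bsub>H2 Y\<^esub> shift Y j g"
  using assms shift_closed[OF assms(1)] shift_closed[OF assms(2)] 
  by (simp add: K.minus_eq_smult shift_add shift_smult)

lemma monom_add:
  assumes "y \<in> carrier Y" "z \<in> carrier Y"
  shows "monom_H2 v (y \<oplus> z) = (\<lambda>w. monom_H2 v y w \<oplus> monom_H2 v z w)"
  using assms by (auto simp: monom_H2_def restr_def)

lemma monom_smult:
  "monom_H2 v (a \<odot> y) = (\<lambda>w. a \<odot> monom_H2 v y w)"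
  using smult_r_null[of a] by (auto simp: monom_H2_def restr_def carrier_class)

lemma shift_monom: "shift Y j (monom_H2 v y) = monom_H2 (v @ [j]) y"
proof
  fix w show "shift Y j (monom_H2 v y) w = monom_H2 (v @ [j]) y w"
    by (cases w rule: rev_cases) (auto simp: shift_def monom_H2_def restr_def)
qed

text \<open>
  The operator of the last letter of a word acts first, while shifts append letters on the right; so the
  shifts build \<open>v\<close> from the transposed word, as in the left evaluation.
\<close>

lemma op_word_shift_monom: "op_word (shift Y) (rev v) (monom_H2 [] y) = monom_H2 v y"
  by (induction v rule: rev_induct) (simp_all add: op_word_def shift_monom)

lemma op_word_backshift: "op_word backshift v f = (\<lambda>w. f (w @ v))"
  by (induction v) (simp_all add: op_word_def backshift_def)

text \<open>Every word of length at least \<open>n\<close> is uniquely \<open>wv\<close> with \<open>|v| = n\<close>.\<close>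

lemma sum_hnorm_backshift_words:
  fixes f :: "'d::finite list \<Rightarrow> 'y"
  assumes f: "f \<in> carrier (H2 Y)"
  shows "(\<Sum>v | length v = n. (hnorm (H2 Y) (op_word backshift v f))\<^sup>2) =
    (\<Sum>\<^sub>\<infinity>u\<in>{u. n \<le> length u}. (hnorm Y (f u))\<^sup>2)"
proof -
  define g where "g = (\<lambda>u. (hnorm Y (f u))\<^sup>2)"
  let ?L = "{v :: 'd list. length v = n}"
  let ?h = "\<lambda>(v, w). w @ v"
  have fin: "finite ?L" using finite_lists_length_eq[of "UNIV :: 'd set" n] by simp
  have inj: "inj_on ?h (?L \<times> UNIV)" by (auto simp: inj_on_def)
  have img: "?h ` (?L \<times> UNIV) = {u. n \<le> length u}"
  proof
    show "{u. n \<le> length u} \<subseteq> ?h ` (?L \<times> UNIV)"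
    proof
      fix u :: "'d list" assume "u \<in> {u. n \<le> length u}"
      then show "u \<in> ?h ` (?L \<times> UNIV)"
        by (intro image_eqI[of _ _ "(drop (length u - n) u, take (length u - n) u)"]) auto
    qed
  qed auto
  have g: "g summable_on A" for A unfolding g_def using H2D(2)[OF f] .
  have summ: "(g \<circ> ?h) summable_on (?L \<times> UNIV)"
    using summable_on_reindex[OF inj, of g] g by blast
  have word: "op_word backshift v f \<in> carrier (H2 Y)" for v
    by (induction v) (use f in \<open>auto simp: op_word_def backshift_closed\<close>)
  have "infsum g {u. n \<le> length u} = infsum (g \<circ> ?h) (?L \<times> UNIV)"
    using infsum_reindex[OF inj, of g] img by simp
  also have "\<dots> = (\<Sum>\<^sub>\<infinity>v\<in>?L. \<Sum>\<^sub>\<infinity>w. (g \<circ> ?h) (v, w))"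
    by (rule infsum_Sigma_banach[OF summ, symmetric])
  also have "\<dots> = (\<Sum>v\<in>?L. \<Sum>\<^sub>\<infinity>w. g (w @ v))"
    using fin by simp
  also have "\<dots> = (\<Sum>v | length v = n. (hnorm (H2 Y) (op_word backshift v f))\<^sup>2)"
    unfolding hnorm_H2_sq[OF word] by (simp add: g_def op_word_backshift)
  finally show ?thesis by (simp add: g_def)
qed

lemma hnorm_minus_restr_sq:
  assumes f: "f \<in> carrier (H2 Y)"
  shows "(hnorm (H2 Y) (f \<ominus>\<^bsub>H2 Y\<^esub> restr S f))\<^sup>2 = 
    (\<Sum>\<^sub>\<infinity>v. (hnorm Y (f v))\<^sup>2) - (\<Sum>\<^sub>\<infinity>v\<in>S. (hnorm Y (f v))\<^sup>2)"
  unfolding minus_restr[OF f] hnorm_restr_sq[OF f] Compl_eq_Diff_UNIV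
  by (rule infsum_Diff) (use H2D(2)[OF f] in auto)

lemma restr_tendsto:
  assumes f: "f \<in> carrier (H2 Y)"
  shows "((\<lambda>F. hnorm (H2 Y) (restr F f \<ominus>\<^bsub>H2 Y\<^esub> f)) \<longlongrightarrow> 0) (finite_subsets_at_top UNIV)"
proof -
  let ?s = "\<Sum>\<^sub>\<infinity>v. (hnorm Y (f v))\<^sup>2"
  have "(sum (\<lambda>v. (hnorm Y (f v))\<^sup>2) \<longlongrightarrow> ?s) (finite_subsets_at_top UNIV)"
    using has_sum_infsum[OF H2D(2)[OF f, of UNIV]] by (simp add: has_sum_def)
  then have lim: "((\<lambda>F. sqrt (?s - sum (\<lambda>v. (hnorm Y (f v))\<^sup>2) F)) \<longlongrightarrow> sqrt (?s - ?s)) (finite_subsets_at_top UNIV)"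
    by (intro tendsto_intros)
  have "hnorm (H2 Y) (restr F f \<ominus>\<^bsub>H2 Y\<^esub> f) = sqrt (?s - sum (\<lambda>v. (hnorm Y (f v))\<^sup>2) F)"
    if "finite F" for F
  proof -
    have "0 \<le> hnorm (H2 Y) (f \<ominus>\<^bsub>H2 Y\<^esub> restr F f)"
      using f restr_closed[OF f, of F] by simp
    from real_sqrt_unique[OF hnorm_minus_restr_sq[OF f, of F] this]
    show ?thesis
      using f restr_closed[OF f, of F] by (simp only: infsum_finite[OF that] K.hnorm_minus_commute)
  qed
  then have "\<forall>\<^sub>F F in finite_subsets_at_top UNIV. 
      hnorm (H2 Y) (restr F f \<ominus>\<^bsub>H2 Y\<^esub> f) = sqrt (?s - sum (\<lambda>v. (hnorm Y (f v))\<^sup>2) F)"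
    by (rule eventually_finite_subsets_at_top_weakI)
  from tendsto_cong[OF this] show ?thesis using lim by simp
qed

lemma tail_tendsto:
  assumes f: "f \<in> carrier (H2 Y)"
  shows "(\<lambda>n. \<Sum>\<^sub>\<infinity>u\<in>{u. n \<le> length u}. (hnorm Y (f u))\<^sup>2) \<longlonglongrightarrow> 0"
proof (rule LIMSEQ_I)
  fix e :: real assume e: "e > 0"
  define g where "g = (\<lambda>u. (hnorm Y (f u))\<^sup>2)"
  have g: "g summable_on A" "0 \<le> g u" for A u unfolding g_def using H2D(2)[OF f] by auto
  obtain F where F: "finite F" "dist (sum g F) (infsum g UNIV) \<le> e / 2"
    using infsum_finite_approximation[OF g(1)[of UNIV], of "e/2"] e by auto
  define m where "m = Suc (Max (insert 0 (length ` F)))"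
  have m: "length u < m" if "u \<in> F" for u
    using that F(1) unfolding m_def by (simp add: le_imp_less_Suc)
  have "norm (infsum g {u. n \<le> length u} - 0) < e" if n: "n \<ge> m" for n
  proof -
    have "infsum g {u. n \<le> length u} \<le> infsum g (UNIV - F)"
      using g m n by (intro infsum_mono2) force+
    also have "\<dots> = infsum g UNIV - sum g F"
      using infsum_Diff[OF g(1)[of UNIV] g(1)[of F]] F(1) by simp
    also have "\<dots> < e" using F(2) e unfolding dist_real_def by linarith
    finally show ?thesis using infsum_nonneg[of "{u. n \<le> length u}" g] g by simp
  qed
  then show "\<exists>no. \<forall>n\<ge>no. norm ((\<Sum>\<^sub>\<infinity>u\<in>{u. n \<le> length u}. (hnorm Y (f u))\<^sup>2) - 0) < e"
    unfolding g_def by blast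
qed

end

section \<open>Compression of the shifts to the complement of an invariant subspace\<close>

locale shift_invariant_subspace = coefficient_space Y for Y :: "'y hilbert" (structure) +
  fixes M :: "('d::finite list \<Rightarrow> 'y) set"
  assumes M_closed: "closed_subspace (H2 Y) M"
    and M_invariant: "f \<in> M \<Longrightarrow> shift Y j f \<in> M"

sublocale shift_invariant_subspace \<subseteq> proj: closed_subspace_of_hilbert "H2 Y" M
  by (intro closed_subspace_of_hilbert.intro closed_subspace_of_hilbert_axioms.intro 
      complex_hilbert_space_H2 M_closed)

context shift_invariant_subspace
begin

abbreviation state_space :: "('d list \<Rightarrow> 'y) hilbert"
  where "state_space \<equiv> (H2 Y)\<lparr>carrier := proj.N\<rparr>"

definition Z :: "'d \<Rightarrow> ('d list \<Rightarrow> 'y) \<Rightarrow> 'd list \<Rightarrow> 'y"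
  where "Z j f = proj.P (shift Y j f)"

definition X :: "'y \<Rightarrow> 'd list \<Rightarrow> 'y"
  where "X y = proj.P (monom_H2 [] y)"

sublocale state: complex_hilbert_space state_space
  by (rule proj.complex_hilbert_space_orth_compl) (use proj.M_carrier in blast)

lemma bounded_op_Z: "bounded_op state_space state_space (Z j)"
  unfolding bounded_op_def
proof (intro conjI ballI allI exI[of _ 1])
  show "Z j \<in> carrier state_space \<rightarrow> carrier state_space"
    using proj.P_in_N[OF shift_closed[OF proj.N_carrier]] by (simp add: Z_def)
  fix f assume f: "f \<in> carrier state_space"
  then have fK: "f \<in> carrier (H2 Y)" using proj.N_carrier by simp
  note sf = shift_closed[OF fK, of j]
  show "hnorm state_space (Z j f) \<le> 1 * hnorm state_space f"
    using proj.hnorm_P_le[OF sf] hnorm_shift[OF fK, of j] by (simp add: Z_def)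
  show "Z j (a \<odot>\<^bsub>state_space\<^esub> f) = a \<odot>\<^bsub>state_space\<^esub> Z j f" for a
    using proj.P_smult[OF sf] by (simp add: Z_def shift_smult)
  fix g assume "g \<in> carrier state_space"
  then have gK: "g \<in> carrier (H2 Y)" using proj.N_carrier by simp
  show "Z j (f \<oplus>\<^bsub>state_space\<^esub> g) = Z j f \<oplus>\<^bsub>state_space\<^esub> Z j g"
    using proj.P_add[OF sf shift_closed[OF gK]] by (simp add: Z_def shift_add)
qed

lemma bounded_op_X: "bounded_op Y state_space X"
  unfolding bounded_op_def
proof (intro conjI ballI allI exI[of _ 1])
  show "X \<in> carrier Y \<rightarrow> carrier state_space"
    using proj.P_in_N[OF monom_closed] by (simp add: X_def)
  fix y assume y: "y \<in> carrier Y"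
  note my = monom_closed[OF y, of "[] :: 'd list"]
  show "hnorm state_space (X y) \<le> 1 * hnorm Y y"
    using proj.hnorm_P_le[OF my] hnorm_monom[OF y, of "[] :: 'd list"] by (simp add: X_def)
  show "X (a \<odot> y) = a \<odot>\<^bsub>state_space\<^esub> X y" for a
    using proj.P_smult[OF my] by (simp add: X_def monom_smult)
  fix z assume z: "z \<in> carrier Y"
  show "X (y \<oplus> z) = X y \<oplus>\<^bsub>state_space\<^esub> X z"
    using proj.P_add[OF my monom_closed[OF z]] by (simp add: X_def monom_add y z)
qed

text \<open>The adjoints of operators that leave \<open>M\<close> invariant leave its complement invariant.\<close>

lemma backshift_orth_compl:
  assumes f: "f \<in> proj.N"
  shows "backshift j f \<in> proj.N"
proof -
  have fK: "f \<in> carrier (H2 Y)" by (rule proj.N_carrier[OF f])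
  have "ip (H2 Y) (backshift j f) m = 0" if m: "m \<in> M" for m
  proof -
    have mK: "m \<in> carrier (H2 Y)" by (rule proj.M_carrier[OF m])
    have "ip (H2 Y) f (shift Y j m) = 0"
      using K.orth_complD(2)[OF f M_invariant[OF m]] .
    then have "ip (H2 Y) m (backshift j f) = 0"
      using ip_shift[OF mK fK, of j] K.ip_commute[OF fK shift_closed[OF mK], of j] by simp
    then show ?thesis
      using K.ip_commute[OF mK backshift_closed[OF fK], of j] by simp
  qed
  then show ?thesis using backshift_closed[OF fK] by (simp add: orth_compl_def)
qed

text \<open>
  Because the backward shift preserves the complement of \<open>M\<close>, the adjoint of the compressed shift is
  its plain restriction, without a projection.
\<close>

lemma adjoint_Z:
  assumes f: "f \<in> proj.N"
  shows "adjoint_op state_space state_space (Z j) f = backshift j f"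
proof (rule adjoint_op_eqI)
  show "complex_inner_space state_space" by (rule state.complex_inner_space_axioms)
  show "backshift j f \<in> carrier state_space" using backshift_orth_compl[OF f] by simp
  fix h assume "h \<in> carrier state_space"
  then have h: "h \<in> carrier (H2 Y)" using proj.N_carrier by simp
  show "ip state_space (Z j h) f = ip state_space h (backshift j f)"
    using proj.ip_P[OF shift_closed[OF h] f] ip_shift[OF h proj.N_carrier[OF f]] by (simp add: Z_def)
qed

lemma adjoint_X:
  assumes f: "f \<in> proj.N"
  shows "adjoint_op Y state_space X f = f []"
proof (rule adjoint_op_eqI)
  show "complex_inner_space Y" by (rule complex_inner_space_axioms)
  show "f [] \<in> carrier Y" using H2D(1)[OF proj.N_carrier[OF f]] .
  fix y assume y: "y \<in> carrier Y"
  show "ip state_space (X y) f = ip Y y (f [])"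
    using proj.ip_P[OF monom_closed[OF y] f] ip_monom[OF y proj.N_carrier[OF f]] by (simp add: X_def)
qed

text \<open>
  In the full space, \<open>f - \<Sum>\<^sub>j S\<^sub>j S\<^sub>j\<^sup>* f\<close> is the constant term of \<open>f\<close>, since every nonempty word has exactly
  one last letter. Projecting this identity to the complement of \<open>M\<close> gives the isometry condition.
\<close>

lemma isometric: "isometric_input_pair Y state_space Z X"
  unfolding isometric_input_pair_def input_pair_def
proof (intro conjI allI ballI bounded_op_Z bounded_op_X)
  show "complex_hilbert_space state_space" by (rule state.complex_hilbert_space_axioms)
  fix f assume "f \<in> carrier state_space"
  then have f: "f \<in> proj.N" by simp
  note fK = proj.N_carrier[OF f]
  let ?S = "\<lambda>j. {w :: 'd list. w \<noteq> [] \<and> last w = j}"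
  let ?T = "\<Union>j. ?S j"
  have ZZ: "Z j (adjoint_op state_space state_space (Z j) f) = proj.P (restr (?S j) f)" for j
    by (simp add: adjoint_Z[OF f] Z_def shift_backshift)
  have PN: "proj.P (restr (?S j) f) \<in> proj.N" for j 
    by (rule proj.P_in_N[OF restr_closed[OF fK]])
  have "(\<Oplus>\<^bsub>state_space\<^esub>j\<in>UNIV. Z j (adjoint_op state_space state_space (Z j) f)) =
      finsum (H2 Y) (\<lambda>j. proj.P (restr (?S j) f)) UNIV"
    unfolding ZZ by (rule K.finsum_submodule[OF proj.subN]) (use PN in auto)
  also have "\<dots> = proj.P (finsum (H2 Y) (\<lambda>j. restr (?S j) f) UNIV)"
    using proj.P_finsum[of UNIV "\<lambda>j. restr (?S j) f"] restr_closed[OF fK] by simp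
  also have "finsum (H2 Y) (\<lambda>j. restr (?S j) f) UNIV = restr ?T f"
    by (rule finsum_restr[OF fK]) (auto simp: disjoint_family_on_def)
  finally have sum: "(\<Oplus>\<^bsub>state_space\<^esub>j\<in>UNIV. Z j (adjoint_op state_space state_space (Z j) f)) =
    proj.P (restr ?T f)" .
  have T: "- ?T = {[]}" by auto
  have "f \<ominus>\<^bsub>state_space\<^esub> proj.P (restr ?T f) = proj.P f \<ominus>\<^bsub>H2 Y\<^esub> proj.P (restr ?T f)"
    using K.minus_submodule[OF proj.subN f] proj.P_in_N[OF restr_closed[OF fK]] f by simp
  also have "\<dots> = proj.P (f \<ominus>\<^bsub>H2 Y\<^esub> restr ?T f)"
    by (rule proj.P_minus[OF fK restr_closed[OF fK], symmetric])
  also have "\<dots> = proj.P (monom_H2 [] (f []))"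
    unfolding minus_restr[OF fK] T monom_coeff ..
  finally show "f \<ominus>\<^bsub>state_space\<^esub> (\<Oplus>\<^bsub>state_space\<^esub>j\<in>UNIV. Z j (adjoint_op state_space state_space (Z j) f)) =
      X (adjoint_op Y state_space X f)"
    unfolding sum by (simp add: X_def adjoint_X[OF f])
qed

lemma op_word_adjoint_Z:
  assumes f: "f \<in> proj.N"
  shows "op_word (\<lambda>j. adjoint_op state_space state_space (Z j)) v f = op_word backshift v f \<and>
    op_word backshift v f \<in> proj.N"
  by (induction v) (use f in \<open>auto simp: op_word_def adjoint_Z backshift_orth_compl\<close>)

lemma stable: "strongly_stable state_space (\<lambda>j. adjoint_op state_space state_space (Z j))"
  unfolding strongly_stable_def
proof
  fix f assume "f \<in> carrier state_space"
  then have f: "f \<in> proj.N" by simp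
  show "(\<lambda>n. \<Sum>v | length v = n. (hnorm state_space
      (op_word (\<lambda>j. adjoint_op state_space state_space (Z j)) v f))\<^sup>2) \<longlonglongrightarrow> 0"
    using tail_tendsto[OF proj.N_carrier[OF f]] op_word_adjoint_Z[OF f] 
      sum_hnorm_backshift_words[OF proj.N_carrier[OF f]] by simp
qed

text \<open>
  The compression intertwines with the projection: the discarded part \<open>f - P f\<close> lies in \<open>M\<close> and is
  shifted into \<open>M\<close>, where the projection vanishes. Iterating, words in the compressed shifts are the
  projections of words in the shifts.
\<close>

lemma Z_P:
  assumes f: "f \<in> carrier (H2 Y)"
  shows "Z j (proj.P f) = proj.P (shift Y j f)"
proof -
  have Pf: "proj.P f \<in> carrier (H2 Y)" using proj.N_carrier[OF proj.P_in_N[OF f]] .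
  have "shift Y j (f \<ominus>\<^bsub>H2 Y\<^esub> proj.P f) \<in> M"
    using M_invariant[OF proj.minus_P_in_M[OF f]] .
  then show ?thesis
    unfolding Z_def using shift_minus[OF f Pf, of j] shift_closed[OF f] shift_closed[OF Pf] 
    by (intro proj.P_cong_mod_M[symmetric]) simp_all
qed

lemma op_word_Z_P:
  assumes f: "f \<in> carrier (H2 Y)"
  shows "op_word Z v (proj.P f) = proj.P (op_word (shift Y) v f)"
proof -
  have "op_word (shift Y) v f \<in> carrier (H2 Y) \<and> op_word Z v (proj.P f) = proj.P (op_word (shift Y) v f)"
    by (induction v) (use f in \<open>auto simp: op_word_def shift_closed Z_P\<close>)
  then show ?thesis by blast
qed

lemma left_eval_term:
  assumes f: "f \<in> carrier (H2 Y)"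
  shows "op_word Z (rev v) (X (f v)) = proj.P (restr {v} f)"
  using op_word_Z_P[OF monom_closed[OF H2D(1)[OF f, of v]], of "rev v" "[]"]
  by (simp add: X_def op_word_shift_monom monom_coeff)

text \<open>
  The \<open>v\<close>-th term of the evaluation series is the projection of \<open>f\<^sub>v z\<^sup>v\<close>. As the series of \<open>f\<close> converges
  unconditionally to \<open>f\<close> and the projection is contractive, left evaluation is the projection itself.
\<close>

lemma left_eval_eq_P:
  assumes f: "f \<in> carrier (H2 Y)"
  shows "has_left_eval state_space Z X f (proj.P f)"
  unfolding has_left_eval_def has_hsum_def left_eval_term[OF f] 
    state.metric.limitin_metric_dist_null
proof (intro conjI)
  let ?s = "finsum state_space (\<lambda>v. proj.P (restr {v} f))"
  show Pf: "proj.P f \<in> carrier state_space" using proj.P_in_N[OF f] by simp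
  have sum: "?s F = proj.P (restr F f)" if F: "finite F" for F
  proof -
    have PN: "proj.P (restr {v} f) \<in> proj.N" for v by (rule proj.P_in_N[OF restr_closed[OF f]])
    have "?s F = finsum (H2 Y) (\<lambda>v. proj.P (restr {v} f)) F"
      by (rule K.finsum_submodule[OF proj.subN F]) (rule PN)
    also have "\<dots> = proj.P (finsum (H2 Y) (\<lambda>v. restr {v} f) F)"
      using proj.P_finsum[OF F, of "\<lambda>v. restr {v} f"] restr_closed[OF f] by simp
    also have "finsum (H2 Y) (\<lambda>v. restr {v} f) F = restr (\<Union>v\<in>F. {v}) f"
      by (rule finsum_restr[OF f F]) (auto simp: disjoint_family_on_def)
    finally show ?thesis by simp
  qed
  have in_N: "proj.P (restr F f) \<in> proj.N" for F by (rule proj.P_in_N[OF restr_closed[OF f]])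
  show "\<forall>\<^sub>F F in finite_subsets_at_top UNIV. ?s F \<in> carrier state_space"
    by (rule eventually_finite_subsets_at_top_weakI) (simp add: sum in_N)
  have bound: "norm (hdist state_space (?s F) (proj.P f)) \<le> hnorm (H2 Y) (restr F f \<ominus>\<^bsub>H2 Y\<^esub> f)"
    if F: "finite F" for F
  proof -
    have "hdist state_space (?s F) (proj.P f) = hnorm (H2 Y) (proj.P (restr F f) \<ominus>\<^bsub>H2 Y\<^esub> proj.P f)"
      using in_N[of F] Pf K.minus_submodule[OF proj.subN in_N, of "proj.P f" F]
      by (simp add: hdist_def sum[OF F])
    also have "\<dots> = hnorm (H2 Y) (proj.P (restr F f \<ominus>\<^bsub>H2 Y\<^esub> f))"
      by (simp add: proj.P_minus[OF restr_closed[OF f] f])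
    also have "\<dots> \<le> hnorm (H2 Y) (restr F f \<ominus>\<^bsub>H2 Y\<^esub> f)"
      using restr_closed[OF f] f by (intro proj.hnorm_P_le) simp
    finally show ?thesis by simp
  qed
  show "((\<lambda>F. hdist state_space (?s F) (proj.P f)) \<longlongrightarrow> 0) (finite_subsets_at_top UNIV)"
    by (rule Lim_null_comparison[OF _ restr_tendsto[OF f]])
      (rule eventually_finite_subsets_at_top_weakI, rule bound)
qed

lemma eval_kernel_eq: "eval_kernel Y state_space Z X = M"
proof -
  have "has_left_eval state_space Z X f \<zero>\<^bsub>state_space\<^esub> \<longleftrightarrow> f \<in> M" if f: "f \<in> carrier (H2 Y)" for f
  proof -
    have unique: "s = proj.P f" if "has_left_eval state_space Z X f s" for s
      using state.metric.limitin_metric_unique[OF that[unfolded has_left_eval_def has_hsum_def]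
          left_eval_eq_P[OF f, unfolded has_left_eval_def has_hsum_def]] by simp
    have "has_left_eval state_space Z X f \<zero>\<^bsub>state_space\<^esub> \<longleftrightarrow> proj.P f = \<zero>\<^bsub>state_space\<^esub>"
      using unique[of "\<zero>\<^bsub>state_space\<^esub>"] left_eval_eq_P[OF f] by metis
    then show ?thesis using proj.P_eq_zero_iff[OF f] by simp
  qed
  then show ?thesis using proj.M_carrier by (auto simp: eval_kernel_def)
qed

end

theorem theorem5p1:
  fixes Y :: "'y hilbert" and M :: "('d::finite list \<Rightarrow> 'y) set"
  assumes "complex_hilbert_space Y"
    and "closed_subspace (H2 Y) M"
    and "\<And>j. shift Y j ` M \<subseteq> M"
  shows "\<exists>(H :: ('d list \<Rightarrow> 'y) hilbert) (Z :: 'd \<Rightarrow> ('d list \<Rightarrow> 'y) \<Rightarrow> ('d list \<Rightarrow> 'y)) X.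
    isometric_input_pair Y H Z X \<and>
    strongly_stable H (\<lambda>j. adjoint_op H H (Z j)) \<and>
    M = eval_kernel Y H Z X"
proof -
  interpret coefficient_space Y by (rule coefficient_space.intro) fact
  interpret shift_invariant_subspace Y M
    by unfold_locales (use assms in auto)
  show ?thesis using isometric stable eval_kernel_eq by blast
qed

end
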